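(* Let $X$ be a Banach space. If $\mathrm{LKK}^*(X)\cap\pi_{1,\varepsilon}^+\neq\emptyset$ for all $\varepsilon>0$ (in particular, if $X$ satisfies the $(1,s)$-LKK$^*$ property for some $s\in(0,1]$), then $X^*$ has the uniform Kadec-Klee property in the weak$^*$ topology (UKK$^*$ property).
   Context: $B_Y$ denotes the closed unit ball of a Banach space $Y$. $(r,s)$-LKK$^*$ property ($(r,s)$-Lipschitz weak$^*$ Kadec-Klee property): given $r,s\in(0,1]$, a Banach space $X$ satisfies it if for every $x^*\in X^*$ and every weak$^*$-null sequence $(x_n^* )$ in $X^*$, $\limsup_n\|x^*+x_n^*\|\geq r\|x^*\|+s\limsup_n\|x_n^*\|$. Notation: $\mathrm{LKK}^*(X)=\{(r,s)\in(0,1]^2: X \text{ satisfies the }(r,s)\text{-LKK}^*\text{ property}\}$, and for $\varepsilon>0$, $\pi_{1,\varepsilon}^+=\{(r,s)\in(0,1]^2:\frac{1-r}{s}<\varepsilon\}$. UKK$^*$ property: for a sequence $(x_n)$ put $\mathrm{sep}(x_n)=\inf\{\|x_n-x_m\|:n\neq m\}$. A dual Banach space $Y$ is $\varepsilon$-UKK$^*$ if there exists $\delta\in(0,1)$ such that whenever $C$ is a weak$^*$ compact, convex subset of $B_Y$ with $\sup\{\mathrm{sep}(x_n):(x_n)\subset C\}\geq\varepsilon$, it follows that $C\cap(1-\delta)B_Y\neq\emptyset$. $Y$ has the UKK$^*$ property if it is $\varepsilon$-UKK$^*$ for all $\varepsilon>0$. Here $Y=X^*$ with the weak$^*$ topology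 $\sigma(X^*,X)$. (When $B_{X^*}$ is weak$^*$ sequentially compact, the UKK$^*$ property of $X^*$ can be reformulated as: for each $\varepsilon>0$ there is $\delta>0$ such that every sequence $(x_n^* )$ in $B_{X^*}$ with $\mathrm{sep}(x_n^* )\geq\varepsilon$ and weak$^*$ limit $x^*$ satisfies $\|x^*\|<1-\delta$.) *)

theory Defs
  imports "HOL-Analysis.Analysis"
begin

text \<open>
  The Banach space \<open>X\<close> is a type \<open>'a :: banach\<close>, and its dual is the type \<open>'a \<Rightarrow>\<^sub>L real\<close> with the
  operator norm. The library's strong operator topology is the topology of pointwise convergence,
  which for functionals is the weak* topology \<open>\<sigma>(X*, X)\<close>. A complex Banach space is covered through
  its underlying real space: taking real parts is a norm-preserving weak* homeomorphism between the
  two duals.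
\<close>

abbreviation weak_star_topology :: "('a::banach \<Rightarrow>\<^sub>L real) topology" where
  "weak_star_topology \<equiv> strong_operator_topology"

text \<open>Limes superior is taken in \<^typ>\<open>ereal\<close> because \<^typ>\<open>real\<close> is not a complete lattice.\<close>

definition has_LKK_star :: "'a::banach itself \<Rightarrow> real \<Rightarrow> real \<Rightarrow> bool" where
  "has_LKK_star X r s \<longleftrightarrow>
     (\<forall>(f :: 'a \<Rightarrow>\<^sub>L real) (g :: nat \<Rightarrow> 'a \<Rightarrow>\<^sub>L real).
        limitin weak_star_topology g 0 sequentially \<longrightarrow>
        limsup (\<lambda>n. ereal (norm (f + g n)))
          \<ge> ereal r * ereal (norm f) + ereal s * limsup (\<lambda>n. ereal (norm (g n))))"

definition LKK_star :: "'a::banach itself \<Rightarrow> (real \<times> real) set" where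
  "LKK_star X = {(r, s). r \<in> {0<..1} \<and> s \<in> {0<..1} \<and> has_LKK_star X r s}"

definition pi_one_plus :: "real \<Rightarrow> (real \<times> real) set" where
  "pi_one_plus \<epsilon> = {(r, s). r \<in> {0<..1} \<and> s \<in> {0<..1} \<and> (1 - r) / s < \<epsilon>}"

definition sep :: "(nat \<Rightarrow> 'b::real_normed_vector) \<Rightarrow> real" where
  "sep x = Inf {norm (x n - x m) | n m. n \<noteq> m}"

text \<open>
  The supremum of the empty set of reals is unspecified, so \<open>C \<noteq> {}\<close> is required explicitly;
  for nonempty \<open>C\<close> inside the unit ball, the set of separations is nonempty and bounded by 2.
\<close>

definition eps_UKK_star :: "'a::banach itself \<Rightarrow> real \<Rightarrow> bool" where
  "eps_UKK_star X \<epsilon> \<longleftrightarrow>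
     (\<exists>\<delta>\<in>{0<..<1}. \<forall>C :: ('a \<Rightarrow>\<^sub>L real) set.
        C \<noteq> {} \<and> compactin weak_star_topology C \<and> convex C \<and> C \<subseteq> cball 0 1 \<and>
        Sup {sep x | x :: nat \<Rightarrow> 'a \<Rightarrow>\<^sub>L real. range x \<subseteq> C} \<ge> \<epsilon>
        \<longrightarrow> C \<inter> cball 0 (1 - \<delta>) \<noteq> {})"

definition has_UKK_star :: "'a::banach itself \<Rightarrow> bool" where
  "has_UKK_star X \<longleftrightarrow> (\<forall>\<epsilon>>0. eps_UKK_star X \<epsilon>)"

end

theory Submission
  imports Defs
begin

text \<open>
  If \<open>w\<^sub>n \<rightarrow> w\<close> weak*, \<open>\<parallel>w\<^sub>n\<parallel> \<le> M\<close> and \<open>\<parallel>w\<^sub>n - w\<parallel> \<ge> c\<close>, then \<open>(r,s)\<close>-LKK* gives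
  \<open>r \<parallel>w\<parallel> + s c \<le> M\<close>: weak* limits lose norm, by an amount that beats \<open>1 - r\<close> if \<open>(1 - r) / s\<close> is small
  compared to \<open>c\<close>. For a separated sequence of \<open>C\<close> that has a weak* convergent subsequence this is
  the theorem. Since \<open>X\<close> is arbitrary, such a subsequence has to be extracted from the hypothesis.

  Convex blocks. If no convex block sequence of a bounded sequence converges, then after
  stabilising the oscillation all blocks oscillate by the same \<open>\<theta> > 0\<close>. As in the argument of Hagler and
  Johnson, a single \<open>x\<^sub>k\<close> then splits all \<open>2^k\<close> subsequences of level \<open>k\<close> at once, and ultrafilter limits of averages form a
  bounded dyadic martingale \<open>\<Phi>\<close> in \<open>X*\<close> whose \<open>k\<close>-th increments are seen by \<open>x\<^sub>k\<close>. Below a node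
  \<open>\<sigma>\<close> of almost maximal norm, the averages of the true-children at depth \<open>n\<close> converge weak* to \<open>\<Phi> \<sigma>\<close>
  (squares of martingale increments are summable) at distance at least \<open>\<theta>/4\<close>, so \<open>\<Phi> \<sigma>\<close> is too long.

  Subsequences. If no subsequence converges, stabilise the oscillation \<open>\<theta> > 0\<close> over subsequences and the least
  norm \<open>\<lambda>\<close> in the set of generalised cluster points. Split repeatedly into a binary tree of subsequences and
  choose for each branch \<open>\<beta>\<close> a cluster point \<open>z \<beta>\<close> of norm almost \<open>\<lambda>\<close>. There are uncountably many
  branches and any two \<open>z \<beta>\<close> are separated by a vector \<open>x \<sigma>\<close> of the tree, so some \<open>z \<beta>\<close> stays away, on the
  vectors along \<open>\<beta>\<close>, from all convex combinations of the countably many \<open>z \<gamma>\<close> with \<open>\<gamma>\<close>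
  finitely supported. If \<open>\<gamma>\<^sub>k\<close> are the truncations of \<open>\<beta>\<close>, weak* convergent convex blocks of \<open>z \<gamma>\<^sub>k\<close> therefore
  keep a fixed distance from their limit, whose norm would be less than \<open>\<lambda>\<close>.
\<close>

subsection \<open>Weak* limits\<close>

text \<open>By Tychonoff, the points \<open>ev n\<close> have a cluster point \<open>L\<close> in
  the compact product of the closures of the ranges. Pulling the neighbourhoods of \<open>L\<close>
  back to the indices gives a filter along which every bounded sequence \<open>a\<close> tends to
  \<open>L a\<close>. Applied to indicator sequences, this makes \<open>U\<close> an
  ultrafilter.\<close>

lemma ultrafilter_limits_exist:
  obtains U :: "nat filter" where "U \<noteq> bot" "U \<le> sequentially"
    "\<And>a :: nat \<Rightarrow> real. bounded (range a) \<Longrightarrow> \<exists>l. (a \<longlongrightarrow> l) U"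
proof -
  define B :: "(nat \<Rightarrow> real) \<Rightarrow> real set" where
    \<comment> \<open>Unbounded sequences get the dummy factor \<open>{0}\<close>, so that the
      product runs over a full function type.\<close>
    "B a = (if bounded (range a) then closure (range a) else {0})" for a
  define ev :: "nat \<Rightarrow> (nat \<Rightarrow> real) \<Rightarrow> real" where
    "ev n a = (if bounded (range a) then a n else 0)" for n a
  have "compact (B a)" for a
    by (auto simp: B_def compact_closure)
  then have "compact (PiE UNIV B)"
    by (simp flip: compactin_euclidean_iff euclidean_product_topology add: compactin_PiE)
  moreover have "\<And>n. ev n \<in> PiE UNIV B"
    by (auto simp: ev_def B_def intro!: subsetD[OF closure_subset] rangeI)
  then have "\<forall>\<^sub>F v in filtermap ev sequentially. v \<in> PiE UNIV B"
    by (simp add: eventually_filtermap)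
  ultimately obtain L where L: "inf (nhds L) (filtermap ev sequentially) \<noteq> bot"
    unfolding compact_filter by (metis filtermap_bot_iff sequentially_bot)
  define U where "U = inf (filtercomap ev (nhds L)) sequentially"
  have "U \<noteq> bot"
  proof
    assume "U = bot"
    then have "filtermap ev U = bot" by simp
    then obtain P Q where PQ: "eventually P (filtercomap ev (nhds L))" "eventually Q sequentially"
        "\<And>n. \<not> (P n \<and> Q n)"
      using \<open>U = bot\<close> unfolding U_def by (auto simp: eventually_inf trivial_limit_def)
    then obtain R where R: "eventually R (nhds L)" "\<And>n. R (ev n) \<Longrightarrow> P n"
      by (auto simp: eventually_filtercomap)
    have "eventually (\<lambda>v. \<not> R v) (filtermap ev sequentially)"
      unfolding eventually_filtermap using PQ(2) by eventually_elim (use PQ(3) R(2) in auto)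
    with R(1) have "eventually (\<lambda>_. False) (inf (nhds L) (filtermap ev sequentially))"
      by (auto simp: eventually_inf)
    with L show False by (simp add: trivial_limit_def)
  qed
  moreover have "U \<le> sequentially" by (simp add: U_def)
  moreover have "\<exists>l. (a \<longlongrightarrow> l) U" if "bounded (range a)" for a :: "nat \<Rightarrow> real"
  proof -
    have "filterlim ev (nhds L) U"
      by (rule filterlim_mono[OF filterlim_filtercomap order_refl]) (simp add: U_def)
    then have "limitin (product_topology (\<lambda>_. euclidean) UNIV) ev L U"
      by (simp add: euclidean_product_topology)
    then have "((\<lambda>n. ev n a) \<longlongrightarrow> L a) U"
      by (simp add: limitin_componentwise)
    then show ?thesis using that by (auto simp: ev_def)
  qed
  ultimately show thesis using that by blast
qed

lemma pointwise_limit_blinfun: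
  fixes f :: "'i \<Rightarrow> 'a::real_normed_vector \<Rightarrow>\<^sub>L real"
  assumes "F \<noteq> bot" and f: "\<And>i. norm (f i) \<le> M" and l: "\<And>x. \<exists>l. ((\<lambda>i. f i x) \<longlongrightarrow> l) F"
  obtains z where "norm z \<le> M" "\<And>x. ((\<lambda>i. f i x) \<longlongrightarrow> blinfun_apply z x) F"
proof -
  obtain T where T: "\<And>x. ((\<lambda>i. f i x) \<longlongrightarrow> T x) F" using l by metis
  have M: "norm (T x) \<le> norm x * M" for x
  proof (rule tendsto_upperbound[OF tendsto_norm[OF T] _ \<open>F \<noteq> bot\<close>], rule always_eventually, rule allI)
    show "norm (f i x) \<le> norm x * M" for i
      using norm_blinfun[of "f i" x] mult_right_mono[OF f[of i] norm_ge_zero[of x]]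
      by (simp add: mult.commute)
  qed
  have "bounded_linear T"
  proof (rule bounded_linear_intro[OF _ _ M])
    show "T (x + y) = T x + T y" for x y
      using tendsto_unique[OF \<open>F \<noteq> bot\<close> T[of "x + y"]] tendsto_add[OF T[of x] T[of y]]
      by (simp add: blinfun.add_right)
    show "T (c *\<^sub>R x) = c *\<^sub>R T x" for c x
      using tendsto_unique[OF \<open>F \<noteq> bot\<close> T[of "c *\<^sub>R x"]] tendsto_scaleR[OF tendsto_const T[of x], of c]
      by (simp add: blinfun.scaleR_right)
  qed
  moreover have "0 \<le> M" using f[of undefined] norm_ge_zero order_trans by blast
  ultimately show thesis
    using T M
    by (intro that[of "Blinfun T"])
      (auto simp: bounded_linear_Blinfun_apply mult.commute intro!: norm_blinfun_bound)
qed

lemma limitin_weak_star_iff: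
  fixes f :: "'i \<Rightarrow> 'a::banach \<Rightarrow>\<^sub>L real"
  shows "limitin weak_star_topology f w F \<longleftrightarrow> (\<forall>x. ((\<lambda>i. f i x) \<longlongrightarrow> blinfun_apply w x) F)"
proof -
  have "limitin weak_star_topology f w F \<longleftrightarrow>
      (\<forall>V. open V \<and> blinfun_apply w \<in> V \<longrightarrow> (\<forall>\<^sub>F i in F. blinfun_apply (f i) \<in> V))"
    unfolding limitin_def strong_operator_topology_topspace
    unfolding strong_operator_topology_def openin_pullback_topology
    by (auto simp: ex_simps)
  also have "\<dots> \<longleftrightarrow> limitin (product_topology (\<lambda>_. euclidean) UNIV) (\<lambda>i. blinfun_apply (f i)) w F"
    unfolding euclidean_product_topology limitin_canonical_iff tendsto_def by blast
  also have "\<dots> \<longleftrightarrow> (\<forall>x. ((\<lambda>i. f i x) \<longlongrightarrow> blinfun_apply w x) F)"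
    by (simp add: limitin_componentwise)
  finally show ?thesis .
qed

text \<open>The definition is applied at \<open>w\<close> to the weak* null sequence
  \<open>v n - w\<close>, and both upper limits are replaced by constants. Every later use of the
  LKK* inequality goes through this form.\<close>

lemma LKK_gap:
  fixes w :: "'a::banach \<Rightarrow>\<^sub>L real" and v :: "nat \<Rightarrow> 'a \<Rightarrow>\<^sub>L real"
  assumes "has_LKK_star TYPE('a) r s" "0 < s"
    and lim: "\<And>x. (\<lambda>n. v n x) \<longlonglongrightarrow> blinfun_apply w x"
    and M: "\<And>n. norm (v n) \<le> M" and c: "\<And>n. c \<le> norm (v n - w)"
  shows "r * norm w + s * c \<le> M"
proof -
  have "limitin weak_star_topology (\<lambda>n. v n - w) 0 sequentially"
    using lim by (simp add: limitin_weak_star_iff LIM_zero blinfun.diff_left)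
  then have "ereal r * ereal (norm w) + ereal s * limsup (\<lambda>n. ereal (norm (v n - w)))
      \<le> limsup (\<lambda>n. ereal (norm (w + (v n - w))))"
    using assms(1) unfolding has_LKK_star_def by blast
  also have "\<dots> \<le> ereal M"
    by (rule Limsup_bounded) (simp add: M)
  finally have *: "ereal r * ereal (norm w) + ereal s * limsup (\<lambda>n. ereal (norm (v n - w))) \<le> ereal M" .
  have "ereal c \<le> limsup (\<lambda>n. ereal (norm (v n - w)))"
    by (rule le_Limsup) (simp_all add: c)
  then have "ereal s * ereal c \<le> ereal s * limsup (\<lambda>n. ereal (norm (v n - w)))"
    using \<open>0 < s\<close> by (intro ereal_mult_left_mono) auto
  then have "ereal r * ereal (norm w) + ereal s * ereal c \<le> ereal M"
    using * add_left_mono order_trans by blast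
  then show ?thesis by simp
qed

subsection \<open>Refinements, oscillation and cluster points of sequences\<close>

text \<open>
  For \<open>P = convex\<close> these are the convex block sequences (blocks may overlap); for \<open>P = (\<lambda>_. True)\<close>, where the
  hull is the set itself, the sequences \<open>f \<circ> \<rho>\<close> with \<open>\<rho> n \<ge> n\<close>.
\<close>

definition refines :: "('v set \<Rightarrow> bool) \<Rightarrow> (nat \<Rightarrow> 'v) \<Rightarrow> (nat \<Rightarrow> 'v) \<Rightarrow> bool" where
  "refines P g f \<longleftrightarrow> (\<forall>n. g n \<in> P hull (f ` {n..}))"

lemma refines_refl: "refines P f f"
  by (auto simp: refines_def intro: hull_inc)

lemma refines_trans:
  assumes "refines P h g" "refines P g f"
  shows "refines P h f"
  unfolding refines_def
proof
  fix n
  have "g ` {n..} \<subseteq> P hull (f ` {n..})"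
  proof clarsimp
    fix i assume "n \<le> i"
    then have "P hull (f ` {i..}) \<subseteq> P hull (f ` {n..})"
      by (intro hull_mono image_mono) auto
    then show "g i \<in> P hull (f ` {n..})"
      using assms(2) by (auto simp: refines_def)
  qed
  then have "P hull (g ` {n..}) \<subseteq> P hull (f ` {n..})"
    by (metis hull_hull hull_mono)
  then show "h n \<in> P hull (f ` {n..})"
    using assms(1) by (auto simp: refines_def)
qed

lemma refines_subseq: "(\<And>n. n \<le> \<rho> n) \<Longrightarrow> refines P (\<lambda>n. f (\<rho> n)) f"
  by (auto simp: refines_def intro!: hull_inc)

lemma refines_offset:
  assumes "refines P g f"
  shows "refines P (\<lambda>n. g (n + k)) (\<lambda>n. f (n + k))"
proof -
  have "(\<lambda>n. f (n + k)) ` {n..} = f ` {n + k..}" for n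
    by (auto simp: image_iff Bex_def) (metis le_add_diff_inverse2 add_le_imp_le_diff add_leD2)
  then show ?thesis using assms by (simp add: refines_def)
qed

text \<open>\<open>F (n + j)\<close> refines \<open>F j\<close>, so its entry of index
  \<open>n + j\<close> is built from entries of \<open>F j\<close> of index at least
  \<open>n\<close>. The shift drops the diagonal entries taken from rows before
  \<open>F j\<close>.\<close>

lemma refines_diagonal:
  assumes "\<And>j. refines P (F (Suc j)) (F j)"
  shows "refines P (\<lambda>n. F (n + j) (n + j)) (F j)"
proof -
  have *: "refines P (F (n + j)) (F j)" for n
  proof (induction n)
    case (Suc n)
    then show ?case using refines_trans[OF assms[of "n + j"]] by simp
  qed (simp add: refines_refl)
  have "F (n + j) (n + j) \<in> P hull (F j ` {n..})" for n
    using *[of n] hull_mono[of "F j ` {n + j..}" "F j ` {n..}" P]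
    unfolding refines_def by (meson atLeast_subset_iff image_mono le_add1 subsetD)
  then show ?thesis by (simp add: refines_def)
qed

text \<open>The \<open>P\<close>-hull is an intersection over more sets than the convex hull, hence
  smaller. This transfers facts about convex blocks to subsequences.\<close>

lemma refines_imp_convex:
  assumes "refines P g f" "\<And>S. convex S \<Longrightarrow> P S"
  shows "refines convex g f"
proof -
  have "P hull A \<subseteq> convex hull A" for A
    by (rule hull_antimono) (use assms(2) in blast)
  with assms(1) show ?thesis unfolding refines_def by (meson subsetD)
qed

lemma refines_norm_le:
  fixes f :: "nat \<Rightarrow> 'v::real_normed_vector"
  assumes "refines convex g f" "\<And>n. norm (f n) \<le> M"
  shows "norm (g n) \<le> M"
proof -
  have "convex hull (f ` {n..}) \<subseteq> cball 0 M"
    using assms(2) by (intro hull_minimal) auto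
  with assms(1) show ?thesis by (auto simp: refines_def)
qed

section \<open>Evaluations on convex hulls and asymptotic oscillation\<close>

lemma convex_eval_le: "convex {u :: 'a::real_normed_vector \<Rightarrow>\<^sub>L real. u x \<le> d}"
  unfolding convex_def by (auto simp: blinfun.bilinear_simps convex_bound_le)

lemma convex_eval_less: "convex {u :: 'a::real_normed_vector \<Rightarrow>\<^sub>L real. u x < d}"
  unfolding convex_def by (auto simp: blinfun.bilinear_simps convex_bound_lt)

text \<open>The difference is affine in each argument separately, so the bound passes to the hull
  one argument at a time.\<close>

lemma convex_hull_eval_diff_le:
  fixes u v :: "'a::real_normed_vector \<Rightarrow>\<^sub>L real"
  assumes u: "u \<in> convex hull S" and v: "v \<in> convex hull S"
    and S: "\<And>a b. a \<in> S \<Longrightarrow> b \<in> S \<Longrightarrow> a x - b x \<le> d"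
  shows "u x - v x \<le> d"
proof -
  have "u x - b x \<le> d" if "b \<in> S" for b
    using u hull_minimal[of S "{u. blinfun_apply u x \<le> d + b x}" convex] S that
    by (force simp: convex_eval_le diff_le_eq)
  then have "convex hull S \<subseteq> {v. blinfun_apply v (- x) \<le> d - u x}"
    by (intro hull_minimal convex_eval_le) (auto simp: blinfun.minus_right algebra_simps)
  with v show ?thesis by (auto simp: blinfun.minus_right)
qed

text \<open>For each \<open>x\<close> in the unit ball, this bounds the upper limit minus the lower
  limit of \<open>f n x\<close> by \<open>c\<close>.\<close>

definition oscillation_le :: "(nat \<Rightarrow> 'a::real_normed_vector \<Rightarrow>\<^sub>L real) \<Rightarrow> real \<Rightarrow> bool" where
  "oscillation_le f c \<longleftrightarrow>
    (\<forall>x e. norm x \<le> 1 \<longrightarrow> 0 < e \<longrightarrow> (\<exists>N. \<forall>i\<ge>N. \<forall>j\<ge>N. f i x - f j x \<le> c + e))"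

lemma oscillation_le_refines:
  assumes "refines convex g f" "oscillation_le f c"
  shows "oscillation_le g c"
  unfolding oscillation_le_def
proof (intro allI impI)
  fix x :: 'a and e :: real
  assume "norm x \<le> 1" "0 < e"
  then obtain N where N: "\<And>i j. i \<ge> N \<Longrightarrow> j \<ge> N \<Longrightarrow> f i x - f j x \<le> c + e"
    using assms(2) unfolding oscillation_le_def by metis
  have conv: "g i \<in> convex hull (f ` {N..})" if "i \<ge> N" for i
    using assms(1) that hull_mono[of "f ` {i..}" "f ` {N..}" convex]
    unfolding refines_def by (meson atLeast_subset_iff image_mono subsetD)
  then show "\<exists>N. \<forall>i\<ge>N. \<forall>j\<ge>N. g i x - g j x \<le> c + e"
  proof (intro exI allI impI)
    fix i j assume "i \<ge> N" "j \<ge> N"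
    then show "g i x - g j x \<le> c + e"
      using N by (auto intro: convex_hull_eval_diff_le[OF conv conv])
  qed
qed

lemma oscillation_le_offset:
  assumes "oscillation_le (\<lambda>n. f (n + k)) c"
  shows "oscillation_le f c"
  unfolding oscillation_le_def
proof (intro allI impI)
  fix x :: 'a and e :: real
  assume "norm x \<le> 1" "0 < e"
  then obtain N where N: "\<And>i j. i \<ge> N \<Longrightarrow> j \<ge> N \<Longrightarrow> f (i + k) x - f (j + k) x \<le> c + e"
    using assms unfolding oscillation_le_def by metis
  have "f i x - f j x \<le> c + e" if "i \<ge> N + k" "j \<ge> N + k" for i j
    using N[of "i - k" "j - k"] that by simp
  then show "\<exists>N. \<forall>i\<ge>N. \<forall>j\<ge>N. f i x - f j x \<le> c + e" by blast
qed

lemma not_oscillation_leE: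
  assumes "\<not> oscillation_le f c"
  obtains x i j e where "norm x \<le> 1" "0 < e" "\<And>n::nat. n \<le> i n" "\<And>n. n \<le> j n"
    "\<And>n. c + e < f (i n) x - f (j n) x"
proof -
  obtain x e where "norm x \<le> 1" "0 < e" "\<forall>N. \<exists>i\<ge>N. \<exists>j\<ge>N. c + e < f i x - f j x"
    using assms unfolding oscillation_le_def by (auto simp: not_le)
  moreover from this(3) obtain i j where "\<forall>n. n \<le> i n \<and> n \<le> j n \<and> c + e < f (i n) x - f (j n) x"
    by metis
  ultimately show thesis using that by blast
qed

lemma oscillation_le_limits:
  assumes "oscillation_le f c" "norm x \<le> 1" "\<And>n. n \<le> \<rho> n" "\<And>n. n \<le> \<tau> n"
    and "(\<lambda>n. f (\<rho> n) x) \<longlonglongrightarrow> H" "(\<lambda>n. f (\<tau> n) x) \<longlonglongrightarrow> L"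
  shows "H - L \<le> c"
proof (rule field_le_epsilon)
  fix e :: real assume "0 < e"
  then obtain N where N: "\<And>i j. i \<ge> N \<Longrightarrow> j \<ge> N \<Longrightarrow> f i x - f j x \<le> c + e"
    using assms(1,2) unfolding oscillation_le_def by metis
  show "H - L \<le> c + e"
  proof (rule tendsto_upperbound[OF tendsto_diff[OF assms(5,6)]])
    show "\<forall>\<^sub>F n in sequentially. f (\<rho> n) x - f (\<tau> n) x \<le> c + e"
      using eventually_ge_at_top[of N]
      by eventually_elim (meson N assms(3,4) order_trans)
  qed simp
qed

lemma oscillation_le_0_convergent:
  assumes "oscillation_le f 0"
  shows "\<exists>l. (\<lambda>n. f n x) \<longlonglongrightarrow> l"
proof -
  have "Cauchy (\<lambda>n. f n x)"
  proof (rule metric_CauchyI)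
    fix e :: real assume "0 < e"
    \<comment> \<open>Dividing by \<open>a\<close> moves \<open>x\<close> into the unit ball; the
      summand 1 covers \<open>x = 0\<close>.\<close>
    define a where "a = norm x + 1"
    have a: "0 < a" "norm (x /\<^sub>R a) \<le> 1"
      by (auto simp: a_def add_nonneg_pos divide_simps)
    then obtain N where N: "\<And>i j. i \<ge> N \<Longrightarrow> j \<ge> N \<Longrightarrow> f i (x /\<^sub>R a) - f j (x /\<^sub>R a) \<le> 0 + e / (2 * a)"
      using assms \<open>0 < e\<close> unfolding oscillation_le_def by (metis divide_pos_pos mult_pos_pos zero_less_numeral)
    have "f i x - f j x < e" if "i \<ge> N" "j \<ge> N" for i j
    proof -
      have "f i x - f j x \<le> e / 2"
        using mult_left_mono[OF N[OF that] less_imp_le[OF a(1)]] a(1)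
        by (simp add: blinfun.scaleR_right right_diff_distrib flip: mult.assoc)
      then show ?thesis using \<open>0 < e\<close> by linarith
    qed
    then show "\<exists>M. \<forall>m\<ge>M. \<forall>n\<ge>M. dist (f m x) (f n x) < e"
      unfolding dist_real_def abs_less_iff by (intro exI[of _ N]) (auto simp: algebra_simps)
  qed
  then show ?thesis using Cauchy_convergent_iff convergent_def by blast
qed

text \<open>An exhaustion argument: \<open>v g\<close> is the least oscillation bound of
  \<open>g\<close> and \<open>low g\<close> the infimum of \<open>v\<close> over its refinements.
  Refinements \<open>F k\<close> are chosen greedily, \<open>F (Suc k)\<close> within
  \<open>1 / Suc k\<close> of \<open>low (F k)\<close>, and the diagonal sequence inherits stability
  from all of them.\<close>

lemma stable_oscillation:
  fixes f :: "nat \<Rightarrow> 'a::real_normed_vector \<Rightarrow>\<^sub>L real"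
  assumes f: "\<And>n. norm (f n) \<le> 1" and P: "\<And>S :: ('a \<Rightarrow>\<^sub>L real) set. convex S \<Longrightarrow> P S"
  obtains g \<theta> where "refines P g f" "0 \<le> \<theta>" "oscillation_le g \<theta>"
    "\<And>h c. refines P h g \<Longrightarrow> 0 \<le> c \<Longrightarrow> oscillation_le h c \<Longrightarrow> \<theta> \<le> c"
proof -
  define v where "v g = Inf {c. 0 \<le> c \<and> oscillation_le g c}" for g :: "nat \<Rightarrow> 'a \<Rightarrow>\<^sub>L real"
  have v_le: "v g \<le> c" if "0 \<le> c" "oscillation_le g c" for g c
    unfolding v_def by (rule cInf_lower) (use that in \<open>auto intro: bdd_belowI[of _ 0]\<close>)
  have v: "0 \<le> v g" "oscillation_le g (v g)" if "refines P g f" for g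
  proof -
    have "oscillation_le g 2"
      unfolding oscillation_le_def
    proof (intro allI impI exI[of _ 0])
      fix x :: 'a and e :: real and i j assume "norm x \<le> 1" "0 < e"
      have "\<bar>g k x\<bar> \<le> 1" for k
        using norm_blinfun[of "g k" x] refines_norm_le[OF refines_imp_convex[OF that P] f, of k]
          mult_mono[of "norm (g k)" 1 "norm x" 1] \<open>norm x \<le> 1\<close> by auto
      from this[of i] this[of j] show "g i x - g j x \<le> 2 + e" using \<open>0 < e\<close> by auto
    qed
    then have ne: "{c. 0 \<le> c \<and> oscillation_le g c} \<noteq> {}" by force
    show "0 \<le> v g" unfolding v_def by (rule cInf_greatest[OF ne]) auto
    show "oscillation_le g (v g)"
      unfolding oscillation_le_def
    proof (intro allI impI)
      fix x :: 'a and e :: real assume x: "norm x \<le> 1" "0 < e"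
      then obtain c where c: "oscillation_le g c" "c < v g + e / 2"
        using cInf_lessD[OF ne, of "v g + e / 2"] by (auto simp: v_def)
      then obtain N where "\<And>i j. i \<ge> N \<Longrightarrow> j \<ge> N \<Longrightarrow> g i x - g j x \<le> c + e / 2"
        using x unfolding oscillation_le_def by (metis half_gt_zero)
      then show "\<exists>N. \<forall>i\<ge>N. \<forall>j\<ge>N. g i x - g j x \<le> v g + e"
        using c(2) by (intro exI[of _ N]) (smt (verit) field_sum_of_halves)
    qed
  qed
  define low where "low g = Inf {v h | h. refines P h g}" for g
  have low_le: "low g \<le> v h" if "refines P g f" "refines P h g" for g h
    unfolding low_def
  proof (rule cInf_lower)
    show "bdd_below {v h | h. refines P h g}"
      using v(1) refines_trans[OF _ that(1)] by (auto intro!: bdd_belowI[of _ 0])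
  qed (use that in blast)
  have "\<exists>h. refines P h g \<and> v h < low g + 1 / Suc k" for g k
  proof -
    have "{v h | h. refines P h g} \<noteq> {}" using refines_refl by blast
    from cInf_lessD[OF this, of "low g + 1 / Suc k"] show ?thesis
      by (auto simp: low_def)
  qed
  then obtain nxt where nxt: "\<And>g k. refines P (nxt g k) g" "\<And>g k. v (nxt g k) < low g + 1 / Suc k"
    by metis
  define F where "F = rec_nat f (\<lambda>k g. nxt g k)"
  have F: "F 0 = f" "F (Suc k) = nxt (F k) k" for k by (simp_all add: F_def)
  have FS: "refines P (F (Suc k)) (F k)" for k using nxt F by simp
  have Ff: "refines P (F k) f" for k
  proof (induction k)
    case (Suc k)
    then show ?case using refines_trans[OF FS[of k]] by simp
  qed (simp add: F refines_refl)
  define g where "g n = F n n" for n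
  have gF: "refines P (\<lambda>n. g (n + k)) (F k)" for k
    unfolding g_def by (rule refines_diagonal[of P F, OF FS])
  have gf: "refines P g f" using gF[of 0] F by simp
  have "v g \<le> c" if h: "refines P h g" and c: "0 \<le> c" "oscillation_le h c" for h c
  proof (rule field_le_epsilon)
    fix e :: real assume "0 < e"
    then obtain k where k: "1 / Suc k < e" using nat_approx_posE by blast
    \<comment> \<open>A tail of \<open>g\<close> refines \<open>F (Suc k)\<close> and a tail of
      \<open>h\<close> refines \<open>F k\<close>; oscillation only depends on tails. Hence
      \<open>v g\<close> is at most \<open>v (F (Suc k))\<close>, which is below
      \<open>low (F k) + e\<close> and so at most \<open>c + e\<close>.\<close>
    have "oscillation_le (\<lambda>n. g (n + Suc k)) (v (F (Suc k)))"
      using oscillation_le_refines[OF refines_imp_convex[OF gF P] v(2)[OF Ff]] .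
    then have "v g \<le> v (F (Suc k))"
      by (intro v_le v Ff) (rule oscillation_le_offset)
    also have "\<dots> < low (F k) + e" using nxt(2)[of "F k" k] k F by simp
    also have "low (F k) \<le> v (\<lambda>n. h (n + k))"
      by (intro low_le Ff refines_trans[OF refines_offset[OF h] gF])
    also have "\<dots> \<le> c"
      by (intro v_le c oscillation_le_refines[OF refines_subseq c(2)]) simp
    finally show "v g \<le> c + e" by simp
  qed
  then show thesis using that[of g "v g"] gf v[OF gf] by blast
qed

text \<open>
  By Hahn-Banach this is the intersection of the weak* closed convex hulls of the tails of \<open>f\<close>.
\<close>

definition cluster :: "(nat \<Rightarrow> 'a::real_normed_vector \<Rightarrow>\<^sub>L real) \<Rightarrow> ('a \<Rightarrow>\<^sub>L real) set" where
  "cluster f = {z. \<forall>x e. 0 < e \<longrightarrow> (\<forall>N. \<exists>n\<ge>N. blinfun_apply z x < f n x + e)}"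

lemma convex_cluster: "convex (cluster f)"
proof (rule convexI)
  fix u v and a b :: real
  assume uv: "u \<in> cluster f" "v \<in> cluster f" and ab: "0 \<le> a" "0 \<le> b" "a + b = 1"
  show "a *\<^sub>R u + b *\<^sub>R v \<in> cluster f"
    unfolding cluster_def
  proof (clarsimp simp: blinfun.bilinear_simps)
    fix x and e :: real and N :: nat assume "0 < e"
    \<comment> \<open>It suffices to reach the larger of the two values, and the point that attains
      it supplies arbitrarily late indices.\<close>
    have "a * u x + b * v x \<le> max (u x) (v x)"
      using ab by (intro convex_bound_le) auto
    moreover have "\<exists>n\<ge>N. max (u x) (v x) < f n x + e"
      using uv \<open>0 < e\<close> by (auto simp: cluster_def max_def)
    ultimately show "\<exists>n\<ge>N. a * u x + b * v x < f n x + e" by force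
  qed
qed

lemma cluster_closed:
  assumes "\<And>n. v n \<in> cluster f" "\<And>x. (\<lambda>n. v n x) \<longlonglongrightarrow> blinfun_apply w x"
  shows "w \<in> cluster f"
  unfolding cluster_def
proof clarsimp
  fix x and e :: real and N :: nat assume "0 < e"
  then have "\<forall>\<^sub>F n in sequentially. w x - e / 2 < v n x"
    using order_tendstoD(1)[OF assms(2)[of x], of "w x - e / 2"] by simp
  then obtain n where n: "w x - e / 2 < v n x"
    using eventually_happens'[of sequentially] by auto
  obtain m where "m \<ge> N" "v n x < f m x + e / 2"
    using assms(1)[of n] half_gt_zero[OF \<open>0 < e\<close>] unfolding cluster_def by blast
  with n show "\<exists>m\<ge>N. w x < f m x + e" by (intro exI[of _ m]) auto
qed

text \<open>At a given \<open>x\<close>, a convex block cannot exceed all the terms that it mixes: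
  the hull would lie in an open half-space missing the block.\<close>

lemma cluster_refines:
  assumes "refines convex g f"
  shows "cluster g \<subseteq> cluster f"
proof
  fix z assume z: "z \<in> cluster g"
  show "z \<in> cluster f"
    unfolding cluster_def
  proof clarsimp
    fix x and e :: real and N :: nat assume "0 < e"
    with z obtain n where n: "n \<ge> N" "z x < g n x + e" unfolding cluster_def by blast
    have "\<exists>i\<ge>n. g n x \<le> f i x"
    proof (rule ccontr)
      assume "\<not> (\<exists>i\<ge>n. g n x \<le> f i x)"
      then have "convex hull (f ` {n..}) \<subseteq> {u. blinfun_apply u x < g n x}"
        by (intro hull_minimal convex_eval_less) auto
      then show False using assms by (auto simp: refines_def)
    qed
    with n show "\<exists>i\<ge>N. z x < f i x + e" by (metis add_le_cancel_right less_le_trans order_trans)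
  qed
qed

lemma cluster_offset: "cluster f \<subseteq> cluster (\<lambda>n. f (n + k))"
  unfolding cluster_def
proof clarsimp
  fix z x and e :: real and N :: nat
  assume "\<forall>x e. 0 < e \<longrightarrow> (\<forall>N. \<exists>n\<ge>N. blinfun_apply z x < f n x + e)" "0 < e"
  then obtain n where "n \<ge> N + k" "z x < f n x + e" by blast
  then show "\<exists>n\<ge>N. z x < f (n + k) x + e" by (intro exI[of _ "n - k"]) auto
qed

text \<open>Membership in \<open>cluster f\<close> bounds \<open>z\<close> from above only; the
  lower bound comes from the same estimate at \<open>- x\<close>.\<close>

lemma cluster_eval_eq:
  assumes "z \<in> cluster f" "(\<lambda>n. f n x) \<longlonglongrightarrow> l"
  shows "blinfun_apply z x = l"
proof -
  have le: "z y \<le> m" if lim: "(\<lambda>n. f n y) \<longlonglongrightarrow> m" for y m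
  proof (rule field_le_epsilon)
    fix e :: real assume "0 < e"
    then obtain N where "\<And>n. n \<ge> N \<Longrightarrow> f n y < m + e / 2"
      using order_tendstoD(2)[OF lim, of "m + e / 2"] by (auto simp: eventually_sequentially)
    moreover obtain n where "n \<ge> N" "z y < f n y + e / 2"
      using assms(1) half_gt_zero[OF \<open>0 < e\<close>] unfolding cluster_def by blast
    ultimately show "z y \<le> m + e" by fastforce
  qed
  from le[of x l] le[of "- x" "- l"] show ?thesis
    using assms(2) by (simp add: blinfun.minus_right tendsto_minus)
qed

lemma cluster_norm_le:
  assumes "z \<in> cluster f" and f: "\<And>n. norm (f n) \<le> M"
  shows "norm z \<le> M"
proof -
  have le: "z x \<le> M * norm x" for x
  proof (rule field_le_epsilon)
    fix e :: real assume "0 < e"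
    then obtain n where "z x < f n x + e"
      using assms(1) unfolding cluster_def by blast
    moreover have "f n x \<le> M * norm x"
      using norm_blinfun[of "f n" x] mult_right_mono[OF f[of n] norm_ge_zero[of x]] by simp
    ultimately show "z x \<le> M * norm x + e" by simp
  qed
  have "0 \<le> M" using f[of 0] norm_ge_zero order_trans by blast
  then show ?thesis
    using le le[of "- _"] by (auto intro!: norm_blinfun_bound simp: blinfun.minus_right abs_le_iff minus_le_iff)
qed

lemma bounded_range_eval:
  fixes f :: "'i \<Rightarrow> 'a::real_normed_vector \<Rightarrow>\<^sub>L real"
  assumes "\<And>n. norm (f n) \<le> M"
  shows "bounded (range (\<lambda>n. f n x))"
proof -
  have "norm (f n x) \<le> M * norm x" for n
    using norm_blinfun[of "f n" x] mult_right_mono[OF assms[of n] norm_ge_zero[of x]] by simp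
  then show ?thesis by (auto simp: bounded_iff)
qed

lemma cluster_nonempty:
  assumes f: "\<And>n. norm (f n) \<le> M"
  shows "cluster f \<noteq> {}"
proof -
  obtain U :: "nat filter" where U: "U \<noteq> bot" "U \<le> sequentially"
    "\<And>a :: nat \<Rightarrow> real. bounded (range a) \<Longrightarrow> \<exists>l. (a \<longlongrightarrow> l) U"
    using ultrafilter_limits_exist by blast
  have "\<exists>l. ((\<lambda>n. f n x) \<longlongrightarrow> l) U" for x
    by (intro U(3) bounded_range_eval[of f M] f)
  with pointwise_limit_blinfun[where f = f, OF U(1) f]
  obtain z where z: "\<And>x. ((\<lambda>n. f n x) \<longlongrightarrow> blinfun_apply z x) U"
    by blast
  have "z \<in> cluster f"
    unfolding cluster_def
  proof clarsimp
    fix x and e :: real and N :: nat assume "0 < e"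
    then have "\<forall>\<^sub>F n in U. z x - e < f n x"
      by (intro order_tendstoD(1)[OF z]) simp
    moreover have "\<forall>\<^sub>F n in U. n \<ge> N"
      by (rule filter_leD[OF U(2) eventually_ge_at_top])
    ultimately have "\<forall>\<^sub>F n in U. n \<ge> N \<and> z x < f n x + e"
      by eventually_elim auto
    then show "\<exists>n\<ge>N. z x < f n x + e"
      using eventually_happens'[OF U(1)] by blast
  qed
  then show ?thesis by blast
qed

lemma finite_convergent_subseq:
  fixes u :: "'s \<Rightarrow> nat \<Rightarrow> real"
  assumes "finite S" "\<And>s. s \<in> S \<Longrightarrow> bounded (range (u s))"
  shows "\<exists>r. strict_mono r \<and> (\<forall>s\<in>S. \<exists>l. (\<lambda>n. u s (r n)) \<longlonglongrightarrow> l)"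
  using assms
proof (induction S rule: finite_induct)
  case empty
  then show ?case using strict_mono_id by blast
next
  case (insert a S)
  then obtain r where r: "strict_mono (r :: nat \<Rightarrow> nat)" "\<And>s. s \<in> S \<Longrightarrow> \<exists>l. (\<lambda>n. u s (r n)) \<longlonglongrightarrow> l"
    by auto
  have "bounded (range (\<lambda>n. u a (r n)))"
    by (rule bounded_subset[OF insert.prems[of a]]) auto
  then obtain l q where q: "strict_mono (q :: nat \<Rightarrow> nat)" "(\<lambda>n. u a (r (q n))) \<longlonglongrightarrow> l"
    using bounded_imp_convergent_subsequence[of "\<lambda>n. u a (r n)"] by (auto simp: o_def)
  have "\<exists>l. (\<lambda>n. u s (r (q n))) \<longlonglongrightarrow> l" if "s \<in> S" for s
    using r(2)[OF that] LIMSEQ_subseq_LIMSEQ[OF _ q(1)] by (fastforce simp: o_def)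
  with q r(1) show ?case
    by (intro exI[of _ "r \<circ> q"]) (auto simp: strict_mono_def)
qed

lemma LKK_star_pair:
  assumes "\<forall>\<epsilon>>0. LKK_star TYPE('a::banach) \<inter> pi_one_plus \<epsilon> \<noteq> {}" "0 < \<epsilon>"
  obtains r s where "0 < r" "r \<le> 1" "0 < s" "s \<le> 1" "has_LKK_star TYPE('a) r s" "1 - r < \<epsilon> * s"
proof -
  obtain r s where rs: "(r, s) \<in> LKK_star TYPE('a)" "(r, s) \<in> pi_one_plus \<epsilon>"
    using assms by fast
  then have "1 - r < \<epsilon> * s"
    by (auto simp: pi_one_plus_def divide_less_eq)
  with rs show thesis by (intro that[of r s]) (auto simp: LKK_star_def)
qed

subsection \<open>Dyadic martingales\<close>

text \<open>
  The mean over the \<open>2^n\<close> words of length \<open>n\<close>. Words are nodes of the binary tree with the newest letter at the head,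
  so the descendants of \<open>\<sigma>\<close> are the words \<open>\<upsilon> @ \<sigma>\<close>.
\<close>

primrec avg :: "nat \<Rightarrow> (bool list \<Rightarrow> 'v::real_vector) \<Rightarrow> 'v" where
  "avg 0 \<psi> = \<psi> []"
| "avg (Suc n) \<psi> = avg n (\<lambda>\<upsilon>. (1 / 2) *\<^sub>R (\<psi> (True # \<upsilon>) + \<psi> (False # \<upsilon>)))"

lemma avg_add: "avg n (\<lambda>\<upsilon>. f \<upsilon> + g \<upsilon>) = avg n f + avg n g"
proof (induction n arbitrary: f g)
  case (Suc n)
  show ?case
    by (simp only: avg.simps Suc[symmetric]) (simp add: algebra_simps)
qed simp

lemma avg_scaleR: "avg n (\<lambda>\<upsilon>. c *\<^sub>R f \<upsilon>) = c *\<^sub>R avg n f"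
proof (induction n arbitrary: f)
  case (Suc n)
  show ?case
    by (simp only: avg.simps Suc[symmetric]) (simp add: algebra_simps)
qed simp

lemma avg_diff: "avg n (\<lambda>\<upsilon>. f \<upsilon> - g \<upsilon>) = avg n f - avg n g"
  using avg_add[of n f "\<lambda>\<upsilon>. (-1) *\<^sub>R g \<upsilon>"] by (simp only: avg_scaleR) simp

lemma avg_mono:
  fixes f g :: "bool list \<Rightarrow> real"
  assumes "\<And>\<upsilon>. length \<upsilon> = n \<Longrightarrow> f \<upsilon> \<le> g \<upsilon>"
  shows "avg n f \<le> avg n g"
  using assms
proof (induction n arbitrary: f g)
  case (Suc n)
  show ?case
    unfolding avg.simps by (rule Suc.IH) (auto intro!: add_mono Suc.prems)
qed simp

lemma avg_const: "avg n (\<lambda>_. c) = c"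
  by (induction n) (simp_all flip: scaleR_2)

lemma avg_in_convex:
  assumes "convex C" "\<And>\<upsilon>. f \<upsilon> \<in> C"
  shows "avg n f \<in> C"
  using assms(2)
proof (induction n arbitrary: f)
  case (Suc n)
  show ?case
    unfolding avg.simps
    by (rule Suc.IH) (use convexD[OF assms(1), of _ _ "1/2" "1/2"] Suc.prems in \<open>simp add: scaleR_add_right\<close>)
qed simp

lemma avg_norm_le:
  fixes f :: "bool list \<Rightarrow> 'v::real_normed_vector"
  shows "(\<And>\<upsilon>. norm (f \<upsilon>) \<le> M) \<Longrightarrow> norm (avg n f) \<le> M"
  using avg_in_convex[of "cball 0 M" f n] by simp

lemma avg_eval: "blinfun_apply (avg n \<Psi>) x = avg n (\<lambda>\<upsilon>. blinfun_apply (\<Psi> \<upsilon>) x)"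
  by (induction n arbitrary: \<Psi>) (simp_all add: blinfun.bilinear_simps)

lemma avg_tendsto:
  fixes f :: "'i \<Rightarrow> bool list \<Rightarrow> real"
  assumes "\<And>\<upsilon>. length \<upsilon> = n \<Longrightarrow> ((\<lambda>k. f k \<upsilon>) \<longlongrightarrow> l \<upsilon>) F"
  shows "((\<lambda>k. avg n (f k)) \<longlongrightarrow> avg n l) F"
  using assms
proof (induction n arbitrary: f l)
  case (Suc n)
  show ?case
    unfolding avg.simps by (rule Suc.IH) (auto intro!: tendsto_intros Suc.prems)
qed simp

text \<open>The recursion of \<open>avg\<close> splits off the newest letter. Splitting off the
  oldest one instead compares the mean below a node with the means below its two children.\<close>

lemma avg_snoc:
  "avg (Suc n) \<psi> = (1 / 2) *\<^sub>R (avg n (\<lambda>\<upsilon>. \<psi> (\<upsilon> @ [True])) + avg n (\<lambda>\<upsilon>. \<psi> (\<upsilon> @ [False])))"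
proof (induction n arbitrary: \<psi>)
  case (Suc n)
  have "avg (Suc (Suc n)) \<psi> = avg (Suc n) (\<lambda>\<upsilon>. (1 / 2) *\<^sub>R (\<psi> (True # \<upsilon>) + \<psi> (False # \<upsilon>)))"
    by simp
  also have "\<dots> = (1 / 2) *\<^sub>R (avg (Suc n) (\<lambda>\<upsilon>. \<psi> (\<upsilon> @ [True])) + avg (Suc n) (\<lambda>\<upsilon>. \<psi> (\<upsilon> @ [False])))"
    by (subst Suc.IH) simp
  finally show ?case .
qed simp

lemma avg_square_le: "(avg n f)\<^sup>2 \<le> avg n (\<lambda>\<upsilon>. (f \<upsilon> :: real)\<^sup>2)"
proof (induction n arbitrary: f)
  case (Suc n)
  have "((a + b) / 2)\<^sup>2 \<le> (a\<^sup>2 + b\<^sup>2) / 2" for a b :: real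
    using sum_squares_ge_zero[of "a - b" 0] by (simp add: power2_eq_square field_simps)
  then have "avg n (\<lambda>\<upsilon>. ((1 / 2) *\<^sub>R (f (True # \<upsilon>) + f (False # \<upsilon>)))\<^sup>2)
      \<le> avg n (\<lambda>\<upsilon>. (1 / 2) *\<^sub>R ((f (True # \<upsilon>))\<^sup>2 + (f (False # \<upsilon>))\<^sup>2))"
    by (intro avg_mono) simp
  with Suc show ?case
    unfolding avg.simps by (rule order_trans)
qed simp

text \<open>The \<open>2 ^ n\<close> deficits \<open>c - f \<upsilon>\<close> are nonnegative and
  add up to at most \<open>2 ^ n * d\<close>, so each is at most that.\<close>

lemma avg_near_max:
  fixes f :: "bool list \<Rightarrow> real"
  assumes "\<And>\<upsilon>. length \<upsilon> = n \<Longrightarrow> f \<upsilon> \<le> c" "c - d \<le> avg n f" "length \<upsilon> = n"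
  shows "c - 2 ^ n * d \<le> f \<upsilon>"
  using assms
proof (induction n arbitrary: f d \<upsilon>)
  case (Suc n)
  obtain b \<omega> where \<upsilon>: "\<upsilon> = b # \<omega>" "length \<omega> = n"
    using Suc.prems(3) by (auto simp: length_Suc_conv)
  have avg: "c - 2 ^ n * d \<le> (1 / 2) *\<^sub>R (f (True # \<omega>) + f (False # \<omega>))"
  proof (rule Suc.IH[where f = "\<lambda>\<upsilon>. (1 / 2) *\<^sub>R (f (True # \<upsilon>) + f (False # \<upsilon>))"])
    show "(1 / 2) *\<^sub>R (f (True # \<upsilon>) + f (False # \<upsilon>)) \<le> c" if "length \<upsilon> = n" for \<upsilon>
      using Suc.prems(1)[of "True # \<upsilon>"] Suc.prems(1)[of "False # \<upsilon>"] that by simp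
  qed (use Suc.prems(2) \<upsilon> in auto)
  have *: "f (b' # \<omega>) \<le> c" for b'
    using Suc.prems(1)[of "b' # \<omega>"] \<upsilon>(2) by simp
  from avg have "c - 2 * (2 ^ n * d) \<le> f (b # \<omega>)"
    using *[of True] *[of False] by (cases b) auto
  then show ?case using \<upsilon>(1) by (simp add: mult.assoc)
qed simp

lemma martingale_avg:
  assumes "\<And>\<upsilon>. \<Psi> \<upsilon> = (1 / 2) *\<^sub>R (\<Psi> (True # \<upsilon>) + \<Psi> (False # \<upsilon>))"
  shows "avg n \<Psi> = \<Psi> []"
  by (induction n) (simp_all only: avg.simps assms[symmetric])

text \<open>The error \<open>h n\<close> is a mean of increments at \<open>x\<close>. By Jensen its
  square is at most \<open>E (Suc n) - E n\<close>, and these differences tend to 0 because the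
  energies \<open>E\<close> increase and are bounded.\<close>

lemma martingale_weak_star_limit:
  fixes \<Psi> :: "bool list \<Rightarrow> 'a::real_normed_vector \<Rightarrow>\<^sub>L real"
  assumes mart: "\<And>\<upsilon>. \<Psi> \<upsilon> = (1 / 2) *\<^sub>R (\<Psi> (True # \<upsilon>) + \<Psi> (False # \<upsilon>))"
    and norm: "\<And>\<upsilon>. norm (\<Psi> \<upsilon>) \<le> M"
  shows "(\<lambda>n. avg n (\<lambda>\<upsilon>. \<Psi> (True # \<upsilon>)) x) \<longlonglongrightarrow> blinfun_apply (\<Psi> []) x"
proof -
  define E where "E n = avg n (\<lambda>\<upsilon>. (\<Psi> \<upsilon> x)\<^sup>2)" for n
  define h where "h n = avg n (\<lambda>\<upsilon>. \<Psi> (True # \<upsilon>)) x - \<Psi> [] x" for n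
  have step: "(h n)\<^sup>2 \<le> E (Suc n) - E n" for n
  proof -
    have val: "\<Psi> \<upsilon> x = (\<Psi> (True # \<upsilon>) x + \<Psi> (False # \<upsilon>) x) / 2" for \<upsilon>
      by (subst mart) (simp add: blinfun.bilinear_simps)
    have "h n = avg n (\<lambda>\<upsilon>. \<Psi> (True # \<upsilon>) x - \<Psi> \<upsilon> x)"
      unfolding h_def avg_diff using martingale_avg[OF mart, of n] by (metis avg_eval)
    then have "(h n)\<^sup>2 \<le> avg n (\<lambda>\<upsilon>. (\<Psi> (True # \<upsilon>) x - \<Psi> \<upsilon> x)\<^sup>2)"
      by (simp add: avg_square_le)
    \<comment> \<open>Orthogonality of increments: the parent value is the midpoint of the
      children's values, so the squared deviation equals the mean of the children's squares minus
      the parent's square.\<close>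
    also have "\<dots> = E (Suc n) - E n"
      unfolding E_def avg.simps avg_diff[symmetric]
    proof (rule arg_cong[where f = "avg n"], rule ext)
      fix \<upsilon>
      show "(\<Psi> (True # \<upsilon>) x - \<Psi> \<upsilon> x)\<^sup>2
          = (1 / 2) *\<^sub>R ((\<Psi> (True # \<upsilon>) x)\<^sup>2 + (\<Psi> (False # \<upsilon>) x)\<^sup>2) - (\<Psi> \<upsilon> x)\<^sup>2"
        unfolding val[of \<upsilon>] by (simp add: power2_eq_square field_simps)
    qed
    finally show ?thesis .
  qed
  have "(\<Psi> \<upsilon> x)\<^sup>2 \<le> (M * norm x)\<^sup>2" for \<upsilon>
    using norm_blinfun[of "\<Psi> \<upsilon>" x] mult_right_mono[OF norm[of \<upsilon>] norm_ge_zero[of x]]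
    by (intro power2_le_iff_abs_le[THEN iffD2]) (auto intro: order_trans[OF abs_ge_zero])
  then have "E n \<le> (M * norm x)\<^sup>2" for n
    using avg_mono[of n "\<lambda>\<upsilon>. (\<Psi> \<upsilon> x)\<^sup>2" "\<lambda>_. (M * norm x)\<^sup>2"] by (simp add: E_def avg_const)
  moreover have "E n \<le> E (Suc n)" for n
    using step[of n] zero_le_power2[of "h n"] by linarith
  then have "incseq E" by (rule incseq_SucI)
  ultimately obtain l where l: "E \<longlonglongrightarrow> l" using incseq_convergent by blast
  have "(\<lambda>n. E (Suc n) - E n) \<longlonglongrightarrow> l - l"
    by (intro tendsto_diff LIMSEQ_Suc l)
  then have "(\<lambda>n. (h n)\<^sup>2) \<longlonglongrightarrow> 0"
    using tendsto_sandwich[of "\<lambda>_. 0" "\<lambda>n. (h n)\<^sup>2" sequentially "\<lambda>n. E (Suc n) - E n" 0] step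
    by simp
  then have "h \<longlonglongrightarrow> 0" by simp
  then show ?thesis unfolding h_def by (rule LIM_zero_cancel)
qed

lemma no_martingale_tree:
  fixes \<Phi> :: "bool list \<Rightarrow> 'a::banach \<Rightarrow>\<^sub>L real"
  assumes LKK: "\<forall>\<epsilon>>0. LKK_star TYPE('a) \<inter> pi_one_plus \<epsilon> \<noteq> {}"
    and mart: "\<And>\<sigma>. \<Phi> \<sigma> = (1 / 2) *\<^sub>R (\<Phi> (True # \<sigma>) + \<Phi> (False # \<sigma>))"
    and norm: "\<And>\<sigma>. norm (\<Phi> \<sigma>) \<le> 1" and x: "\<And>n. norm (x n) \<le> 1" and "0 < \<theta>"
    and gap: "\<And>\<sigma>. \<theta> \<le> \<Phi> (True # \<sigma>) (x (length \<sigma>)) - \<Phi> (False # \<sigma>) (x (length \<sigma>))"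
  shows False
proof -
  obtain r s where rs: "0 < r" "r \<le> 1" "0 < s" "s \<le> 1" "has_LKK_star TYPE('a) r s" "1 - r < \<theta> / 8 * s"
    using LKK_star_pair[OF LKK, of "\<theta> / 8"] \<open>0 < \<theta>\<close> by auto
  define \<nu> where "\<nu> = (SUP \<sigma>. norm (\<Phi> \<sigma>))"
  have bdd: "bdd_above (range (\<lambda>\<sigma>. norm (\<Phi> \<sigma>)))" by (rule bdd_aboveI[of _ 1]) (use norm in auto)
  have \<nu>: "norm (\<Phi> \<sigma>) \<le> \<nu>" for \<sigma> unfolding \<nu>_def by (rule cSUP_upper[OF _ bdd]) simp
  have "\<nu> \<le> 1" unfolding \<nu>_def by (rule cSUP_least) (use norm in auto)
  \<comment> \<open>The node \<sigma> is taken so close to the supremal norm \<nu> that the missing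
    part stays below the gain from the gap.\<close>
  have "\<nu> - \<theta> / 8 * s < \<nu>" using \<open>0 < \<theta>\<close> \<open>0 < s\<close> by simp
  then obtain \<sigma> where \<sigma>: "\<nu> - \<theta> / 8 * s < norm (\<Phi> \<sigma>)"
    unfolding \<nu>_def by (subst (asm) less_cSUP_iff[OF _ bdd]) auto
  define \<Psi> where "\<Psi> \<upsilon> = \<Phi> (\<upsilon> @ \<sigma>)" for \<upsilon>
  have \<Psi>: "\<Psi> \<upsilon> = (1 / 2) *\<^sub>R (\<Psi> (True # \<upsilon>) + \<Psi> (False # \<upsilon>))" for \<upsilon>
    using mart[of "\<upsilon> @ \<sigma>"] by (simp add: \<Psi>_def)
  define w where "w n = avg n (\<lambda>\<upsilon>. \<Psi> (True # \<upsilon>))" for n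
  have "r * norm (\<Psi> []) + s * (\<theta> / 2) \<le> \<nu>"
  proof (rule LKK_gap[OF rs(5,3)])
    show "(\<lambda>n. w n x) \<longlonglongrightarrow> \<Psi> [] x" for x
      unfolding w_def by (rule martingale_weak_star_limit[OF \<Psi>, of \<nu>]) (simp add: \<Psi>_def \<nu>)
    show "norm (w n) \<le> \<nu>" for n
      unfolding w_def by (rule avg_norm_le) (simp add: \<Psi>_def \<nu>)
    show "\<theta> / 2 \<le> norm (w n - \<Psi> [])" for n
    proof -
      \<comment> \<open>One vector tests all nodes of a level, so it sees every increment at depth
        \<open>n\<close> below \<sigma> with the same sign. Each increment is half the difference
        between siblings, whence \<open>\<theta> / 2\<close>.\<close>
      let ?x = "x (n + length \<sigma>)"
      have "w n - \<Psi> [] = avg n (\<lambda>\<upsilon>. \<Psi> (True # \<upsilon>) - \<Psi> \<upsilon>)"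
        unfolding w_def avg_diff by (simp add: martingale_avg[OF \<Psi>])
      then have eq: "(w n - \<Psi> []) ?x = avg n (\<lambda>\<upsilon>. (\<Psi> (True # \<upsilon>) - \<Psi> \<upsilon>) ?x)"
        by (simp add: avg_eval)
      have "\<theta> / 2 \<le> (\<Psi> (True # \<upsilon>) - \<Psi> \<upsilon>) ?x" if "length \<upsilon> = n" for \<upsilon>
        using gap[of "\<upsilon> @ \<sigma>"] that
        by (subst \<Psi>[of \<upsilon>]) (simp add: blinfun.bilinear_simps \<Psi>_def field_simps)
      then have "\<theta> / 2 \<le> (w n - \<Psi> []) ?x"
        unfolding eq using avg_mono[of n "\<lambda>_. \<theta> / 2"] by (simp add: avg_const)
      also have "\<dots> \<le> norm (w n - \<Psi> []) * norm ?x"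
        using norm_blinfun[of "w n - \<Psi> []" ?x] by simp
      also have "\<dots> \<le> norm (w n - \<Psi> [])"
        using x[of "n + length \<sigma>"] by (simp add: mult_left_le)
      finally show ?thesis .
    qed
  qed
  \<comment> \<open>Together the estimates give \<open>s * \<theta> / 2 \<le> (1 - r) + s * \<theta>
    / 8 < s * \<theta> / 4\<close>.\<close>
  moreover have "r * (\<nu> - \<theta> / 8 * s) \<le> r * norm (\<Psi> [])"
    using \<sigma> rs by (simp add: \<Psi>_def)
  moreover have "r * (\<theta> / 8 * s) \<le> 1 * (\<theta> / 8 * s)"
    using rs \<open>0 < \<theta>\<close> by (intro mult_right_mono) auto
  moreover have "(1 - r) * \<nu> \<le> (1 - r) * 1"
    using rs \<open>\<nu> \<le> 1\<close> by (intro mult_left_mono) auto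
  moreover have "0 < s * \<theta>" using rs \<open>0 < \<theta>\<close> by simp
  ultimately show False using rs(6) by (simp add: algebra_simps)
qed

subsection \<open>Convex block sequences\<close>

text \<open>The maps \<rho> and \<tau> select two refinements of \<open>f\<close>, the children of a
  node, which the vector \<open>x\<close> tells apart by \<open>d\<close> in the limit.\<close>

definition splits :: "real \<Rightarrow> (nat \<Rightarrow> 'a::real_normed_vector \<Rightarrow>\<^sub>L real) \<Rightarrow> 'a \<Rightarrow> (nat \<Rightarrow> nat) \<Rightarrow> (nat \<Rightarrow> nat) \<Rightarrow> bool" where
  "splits d f x \<rho> \<tau> \<longleftrightarrow> norm x \<le> 1 \<and> (\<forall>n. n \<le> \<rho> n) \<and> (\<forall>n. n \<le> \<tau> n) \<and>
    (\<exists>H L. (\<lambda>n. f (\<rho> n) x) \<longlonglongrightarrow> H \<and> (\<lambda>n. f (\<tau> n) x) \<longlonglongrightarrow> L \<and> d \<le> H - L)"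

lemma simultaneous_split:
  fixes g :: "nat \<Rightarrow> 'a::real_normed_vector \<Rightarrow>\<^sub>L real" and G :: "bool list \<Rightarrow> nat \<Rightarrow> 'a \<Rightarrow>\<^sub>L real"
  assumes g: "\<And>n. norm (g n) \<le> 1" and P: "\<And>S :: ('a \<Rightarrow>\<^sub>L real) set. convex S \<Longrightarrow> P S"
    and "0 < \<theta>" and osc: "oscillation_le g \<theta>"
    and stable: "\<And>h c. refines P h g \<Longrightarrow> 0 \<le> c \<Longrightarrow> oscillation_le h c \<Longrightarrow> \<theta> \<le> c"
    and G: "\<And>\<sigma>. refines P (G \<sigma>) g" and avgG: "refines P (\<lambda>n. avg k (\<lambda>\<sigma>. G \<sigma> n)) g"
  shows "\<exists>x \<rho> \<tau>. \<forall>\<sigma>. length \<sigma> = k \<longrightarrow> splits (\<theta> / 2) (G \<sigma>) x \<rho> \<tau>"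
proof -
  \<comment> \<open>No \<open>G \<sigma>\<close> oscillates by more than \<open>\<theta>\<close>, so where the mean oscillates by almost \<open>\<theta>\<close>, every \<open>G \<sigma>\<close>
    oscillates by at least \<open>\<theta> / 2\<close>.\<close>
  define a where "a n = avg k (\<lambda>\<sigma>. G \<sigma> n)" for n
  \<comment> \<open>The mean misses \<theta> by at most \<open>\<theta> / 2 ^ Suc k\<close>, so each
    of the \<open>2 ^ k\<close> terms misses it by at most \<open>\<theta> / 2\<close>.\<close>
  define c where "c = \<theta> - \<theta> / 2 ^ Suc k"
  have c: "0 \<le> c" "c < \<theta>"
    using \<open>0 < \<theta>\<close> one_le_power[of "2 :: real" "Suc k"]
    by (simp_all add: c_def divide_le_eq del: one_le_power)
  then have "\<not> oscillation_le a c"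
    using stable[of a c] avgG unfolding a_def by fastforce
  then obtain x i j e where x: "norm x \<le> 1" "0 < e" "\<And>n::nat. n \<le> i n" "\<And>n. n \<le> j n"
    "\<And>n. c + e < a (i n) x - a (j n) x"
    by (rule not_oscillation_leE) blast
  have Gc: "refines convex (G \<sigma>) g" for \<sigma> using refines_imp_convex[OF G P] .
  have Gn: "norm (G \<sigma> n) \<le> 1" for \<sigma> n using refines_norm_le[OF Gc g] .
  \<comment> \<open>All words of length \<open>k\<close> and both index maps are collected in one
    finite family, so that a single subsequence \<open>r\<close> makes every value converge.\<close>
  define u where "u = (\<lambda>(\<sigma>, b) n. G \<sigma> (if b then i n else j n) x)"
  have "bounded (range (u p))" for p
    unfolding u_def using bounded_range_eval[of "\<lambda>n. G (fst p) (if snd p then i n else j n)" 1 x] Gn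
    by (simp add: case_prod_beta)
  moreover have "finite ({\<sigma> :: bool list. length \<sigma> = k} \<times> (UNIV :: bool set))"
    using finite_lists_length_eq[of "UNIV :: bool set" k] by simp
  ultimately obtain r where r: "strict_mono (r :: nat \<Rightarrow> nat)"
    "\<forall>p\<in>{\<sigma>. length \<sigma> = k} \<times> UNIV. \<exists>l. (\<lambda>n. u p (r n)) \<longlonglongrightarrow> l"
    using finite_convergent_subseq[of _ u] by metis
  define \<rho> \<tau> where "\<rho> n = i (r n)" and "\<tau> n = j (r n)" for n
  have ge: "n \<le> \<rho> n" "n \<le> \<tau> n" for n
    unfolding \<rho>_def \<tau>_def using x(3,4) seq_suble[OF r(1)] order_trans by blast+
  have "\<forall>\<sigma> b. \<exists>l. length \<sigma> = k \<longrightarrow> (\<lambda>n. u (\<sigma>, b) (r n)) \<longlonglongrightarrow> l"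
    using r(2) by blast
  then obtain l where l: "\<And>\<sigma> b. length \<sigma> = k \<Longrightarrow> (\<lambda>n. u (\<sigma>, b) (r n)) \<longlonglongrightarrow> l \<sigma> b"
    by metis
  define H L where "H \<sigma> = l \<sigma> True" and "L \<sigma> = l \<sigma> False" for \<sigma>
  have HL: "(\<lambda>n. G \<sigma> (\<rho> n) x) \<longlonglongrightarrow> H \<sigma>" "(\<lambda>n. G \<sigma> (\<tau> n) x) \<longlonglongrightarrow> L \<sigma>" if "length \<sigma> = k" for \<sigma>
    using l[OF that, of True] l[OF that, of False] by (simp_all add: u_def \<rho>_def \<tau>_def H_def L_def)
  have le: "H \<sigma> - L \<sigma> \<le> \<theta>" if "length \<sigma> = k" for \<sigma>
    using oscillation_le_limits[OF oscillation_le_refines[OF Gc osc] x(1) ge HL[OF that]] .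
  have "(\<lambda>n. avg k (\<lambda>\<sigma>. G \<sigma> (\<rho> n) x - G \<sigma> (\<tau> n) x)) \<longlonglongrightarrow> avg k (\<lambda>\<sigma>. H \<sigma> - L \<sigma>)"
    by (intro avg_tendsto tendsto_diff HL)
  moreover have "avg k (\<lambda>\<sigma>. G \<sigma> (\<rho> n) x - G \<sigma> (\<tau> n) x) \<ge> c" for n
    using x(5)[of "r n"] x(2) by (simp add: avg_diff a_def avg_eval \<rho>_def \<tau>_def)
  ultimately have "c \<le> avg k (\<lambda>\<sigma>. H \<sigma> - L \<sigma>)"
    by (intro tendsto_lowerbound[of _ _ sequentially]) auto
  then have "\<theta> - 2 ^ k * (\<theta> / 2 ^ Suc k) \<le> H \<sigma> - L \<sigma>" if "length \<sigma> = k" for \<sigma>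
    using avg_near_max[of k "\<lambda>\<sigma>. H \<sigma> - L \<sigma>" \<theta> "\<theta> / 2 ^ Suc k", OF le _ that] by (simp add: c_def)
  then have "\<theta> / 2 \<le> H \<sigma> - L \<sigma>" if "length \<sigma> = k" for \<sigma>
    using that by (simp add: field_simps)
  with HL x(1) ge have "splits (\<theta> / 2) (G \<sigma>) x \<rho> \<tau>" if "length \<sigma> = k" for \<sigma>
    unfolding splits_def using that by (intro conjI allI exI[of _ "H \<sigma>"] exI[of _ "L \<sigma>"]) auto
  then show ?thesis by blast
qed

lemma refines_avg:
  assumes "\<And>\<sigma>. refines convex (G \<sigma>) g"
  shows "refines convex (\<lambda>n. avg k (\<lambda>\<sigma>. G \<sigma> n)) g"
  unfolding refines_def
  by (intro allI avg_in_convex convex_convex_hull) (use assms in \<open>simp add: refines_def\<close>)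

lemma LIMSEQ_reindex:
  assumes "a \<longlonglongrightarrow> l" "\<And>n::nat. n \<le> \<kappa> n"
  shows "(\<lambda>n. a (\<kappa> n)) \<longlonglongrightarrow> l"
proof (rule filterlim_compose[OF assms(1)])
  show "filterlim \<kappa> at_top sequentially"
    by (rule filterlim_at_top_mono[OF filterlim_ident]) (simp add: assms(2))
qed

lemma splits_children:
  assumes "splits d f x \<rho> \<tau>"
  obtains v where "\<And>b. (\<lambda>n. f ((if b then \<rho> else \<tau>) n) x) \<longlonglongrightarrow> v b" "d \<le> v True - v False"
proof -
  obtain H L where HL: "(\<lambda>n. f (\<rho> n) x) \<longlonglongrightarrow> H" "(\<lambda>n. f (\<tau> n) x) \<longlonglongrightarrow> L" "d \<le> H - L"
    using assms unfolding splits_def by blast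
  show thesis by (rule that[of "\<lambda>b. if b then H else L"]) (use HL in auto)
qed

lemma convex_block_convergent:
  fixes f :: "nat \<Rightarrow> 'a::banach \<Rightarrow>\<^sub>L real"
  assumes LKK: "\<forall>\<epsilon>>0. LKK_star TYPE('a) \<inter> pi_one_plus \<epsilon> \<noteq> {}"
    and f: "\<And>n. norm (f n) \<le> 1"
  obtains g z where "refines convex g f" "\<And>x. (\<lambda>n. g n x) \<longlonglongrightarrow> blinfun_apply z x"
proof -
  obtain g \<theta> where g: "refines convex g f" "0 \<le> \<theta>" "oscillation_le g \<theta>"
    and stable: "\<And>h c. refines convex h g \<Longrightarrow> 0 \<le> c \<Longrightarrow> oscillation_le h c \<Longrightarrow> \<theta> \<le> c"
    by (rule stable_oscillation[where f = f and P = convex, OF f]) blast+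
  have gn: "norm (g n) \<le> 1" for n by (rule refines_norm_le[OF g(1) f])
  have "\<theta> = 0"
  proof (rule ccontr)
    assume "\<theta> \<noteq> 0"
    with g(2) have "0 < \<theta>" by simp
    define \<kappa> where "\<kappa> p b = (if b then fst (snd p) else snd (snd p))"
      for p :: "'a \<times> (nat \<Rightarrow> nat) \<times> (nat \<Rightarrow> nat)" and b
    \<comment> \<open>The choice depends on the whole level \<open>G\<close>, so all words of length
      \<open>k\<close> share one vector and one pair of index maps.\<close>
    define S where "S k G = (SOME p. \<forall>\<sigma>. length \<sigma> = k \<longrightarrow> splits (\<theta> / 2) (G \<sigma>) (fst p) (\<kappa> p True) (\<kappa> p False))"
      for k and G :: "bool list \<Rightarrow> nat \<Rightarrow> 'a \<Rightarrow>\<^sub>L real"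
    have S: "splits (\<theta> / 2) (G \<sigma>) (fst (S k G)) (\<kappa> (S k G) True) (\<kappa> (S k G) False)"
      if "\<And>\<sigma>. refines convex (G \<sigma>) g" "length \<sigma> = k" for k G \<sigma>
    proof -
      have "\<exists>x \<rho> \<tau>. \<forall>\<sigma>. length \<sigma> = k \<longrightarrow> splits (\<theta> / 2) (G \<sigma>) x \<rho> \<tau>"
        by (rule simultaneous_split[OF gn _ \<open>0 < \<theta>\<close> g(3) stable that(1) refines_avg[OF that(1)]])
      then obtain x \<rho> \<tau> where "\<forall>\<sigma>. length \<sigma> = k \<longrightarrow> splits (\<theta> / 2) (G \<sigma>) x \<rho> \<tau>" by blast
      then have "\<exists>p. \<forall>\<sigma>. length \<sigma> = k \<longrightarrow> splits (\<theta> / 2) (G \<sigma>) (fst p) (\<kappa> p True) (\<kappa> p False)"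
        by (intro exI[of _ "(x, \<rho>, \<tau>)"]) (simp add: \<kappa>_def)
      from someI_ex[OF this] that(2) show ?thesis unfolding S_def by blast
    qed
    \<comment> \<open>\<open>F k \<sigma>\<close> is meant for words of length \<open>k\<close>. On
      shorter words \<open>hd []\<close> and \<open>tl []\<close> occur, but the result still
      refines \<open>g\<close>, as \<open>S\<close> demands for every word.\<close>
    define F where "F = rec_nat (\<lambda>_. g) (\<lambda>k G \<sigma> n. G (tl \<sigma>) (\<kappa> (S k G) (hd \<sigma>) n))"
    have F: "F 0 = (\<lambda>_. g)" "F (Suc k) = (\<lambda>\<sigma> n. F k (tl \<sigma>) (\<kappa> (S k (F k)) (hd \<sigma>) n))" for k
      by (simp_all add: F_def)
    have ge: "n \<le> \<kappa> (S k G) b n" if "\<And>\<sigma>. refines convex (G \<sigma>) g" for k G b n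
      using S[of G "replicate k True" k, OF that] by (cases b) (simp_all add: splits_def)
    have Fg: "refines convex (F k \<sigma>) g" for k \<sigma>
    proof (induction k arbitrary: \<sigma>)
      case (Suc k)
      show ?case
        unfolding F by (rule refines_trans[OF refines_subseq Suc]) (rule ge[OF Suc])
    qed (simp add: F refines_refl)
    define p where "p k = S k (F k)" for k
    define x where "x k = fst (p k)" for k
    define t where "t \<sigma> = F (length \<sigma>) \<sigma>" for \<sigma>
    have t_Cons: "t (b # \<sigma>) n = t \<sigma> (\<kappa> (p (length \<sigma>)) b n)" for b \<sigma> n
      by (simp add: t_def F p_def)
    have tn: "norm (t \<sigma> n) \<le> 1" for \<sigma> n
      unfolding t_def by (rule refines_norm_le[OF Fg gn])
    have split: "splits (\<theta> / 2) (t \<sigma>) (x (length \<sigma>)) (\<kappa> (p (length \<sigma>)) True) (\<kappa> (p (length \<sigma>)) False)" for \<sigma>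
      using S[of "F (length \<sigma>)" \<sigma> "length \<sigma>", OF Fg refl] by (simp only: t_def x_def p_def)
    have "\<exists>v. (\<forall>b. (\<lambda>n. t (b # \<sigma>) n (x (length \<sigma>))) \<longlonglongrightarrow> v b) \<and> \<theta> / 2 \<le> v True - v False" for \<sigma>
    proof -
      obtain v where v: "\<And>b. (\<lambda>n. t \<sigma> ((if b then \<kappa> (p (length \<sigma>)) True else \<kappa> (p (length \<sigma>)) False) n) (x (length \<sigma>))) \<longlonglongrightarrow> v b"
          "\<theta> / 2 \<le> v True - v False"
        by (rule splits_children[OF split[of \<sigma>]]) blast
      have "(\<lambda>n. t (b # \<sigma>) n (x (length \<sigma>))) \<longlonglongrightarrow> v b" for b
        using v(1)[of b] by (cases b) (simp_all add: t_Cons)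
      with v(2) show ?thesis by blast
    qed
    then obtain V where V: "\<And>\<sigma> b. (\<lambda>n. t (b # \<sigma>) n (x (length \<sigma>))) \<longlonglongrightarrow> V \<sigma> b"
        "\<And>\<sigma>. \<theta> / 2 \<le> V \<sigma> True - V \<sigma> False"
      by metis
    \<comment> \<open>Descendants only reindex \<open>t (b # \<sigma>)\<close>, so at
      \<open>x (length \<sigma>)\<close> they keep its limit.\<close>
    have V': "(\<lambda>n. t (\<upsilon> @ b # \<sigma>) n (x (length \<sigma>))) \<longlonglongrightarrow> V \<sigma> b" for \<upsilon> b \<sigma>
    proof (induction \<upsilon>)
      case (Cons c \<upsilon>)
      show ?case
        using LIMSEQ_reindex[OF Cons, of "\<kappa> (p (length (\<upsilon> @ b # \<sigma>))) c"] ge[OF Fg]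
        by (simp add: t_Cons p_def)
    qed (simp add: V)
    obtain U :: "nat filter" where U: "U \<noteq> bot" "U \<le> sequentially"
      "\<And>a :: nat \<Rightarrow> real. bounded (range a) \<Longrightarrow> \<exists>l. (a \<longlongrightarrow> l) U"
      using ultrafilter_limits_exist by blast
    have U_limit: "\<exists>z. norm z \<le> 1 \<and> (\<forall>x. ((\<lambda>n. h n x) \<longlongrightarrow> blinfun_apply z x) U)"
      if h: "\<And>n. norm (h n) \<le> 1" for h :: "nat \<Rightarrow> 'a \<Rightarrow>\<^sub>L real"
    proof -
      have "\<exists>l. ((\<lambda>n. h n x) \<longlongrightarrow> l) U" for x
        by (intro U(3) bounded_range_eval[of h 1] h)
      with pointwise_limit_blinfun[where f = h, OF U(1) h] show ?thesis by blast
    qed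
    have "\<forall>\<sigma>. \<exists>z. norm z \<le> 1 \<and> (\<forall>x. ((\<lambda>n. t \<sigma> n x) \<longlongrightarrow> blinfun_apply z x) U)"
      using U_limit tn by blast
    then obtain \<phi> where \<phi>: "\<And>\<sigma>. norm (\<phi> \<sigma>) \<le> 1"
        "\<And>\<sigma> x. ((\<lambda>n. t \<sigma> n x) \<longlongrightarrow> blinfun_apply (\<phi> \<sigma>) x) U"
      by metis
    have \<phi>V: "\<phi> (\<upsilon> @ b # \<sigma>) (x (length \<sigma>)) = V \<sigma> b" for \<upsilon> b \<sigma>
      by (rule tendsto_unique[OF U(1) \<phi>(2) tendsto_mono[OF U(2) V']])
    \<comment> \<open>The limits \<phi> need not form a martingale, so they are averaged over
      descendants. Depth \<open>N - length \<sigma>\<close> below \<sigma> is the absolute level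
      \<open>N\<close>: for large \<open>N\<close>, a node and its two children are averaged over
      the same level, which makes the martingale identity exact.\<close>
    define A where "A N \<sigma> = avg N (\<lambda>\<upsilon>. \<phi> (\<upsilon> @ \<sigma>))" for N \<sigma>
    have "\<forall>\<sigma>. \<exists>z. norm z \<le> 1 \<and> (\<forall>x. ((\<lambda>N. A (N - length \<sigma>) \<sigma> x) \<longlongrightarrow> blinfun_apply z x) U)"
      unfolding A_def by (intro allI U_limit avg_norm_le \<phi>)
    then obtain \<Phi> where \<Phi>: "\<And>\<sigma>. norm (\<Phi> \<sigma>) \<le> 1"
        "\<And>\<sigma> x. ((\<lambda>N. A (N - length \<sigma>) \<sigma> x) \<longlongrightarrow> blinfun_apply (\<Phi> \<sigma>) x) U"
      by metis
    have mart: "\<Phi> \<sigma> = (1 / 2) *\<^sub>R (\<Phi> (True # \<sigma>) + \<Phi> (False # \<sigma>))" for \<sigma>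
    proof (rule blinfun_eqI)
      fix y
      have "A (N - length \<sigma>) \<sigma> y = (1 / 2) *\<^sub>R (A (N - length (True # \<sigma>)) (True # \<sigma>) y
          + A (N - length (False # \<sigma>)) (False # \<sigma>) y)" if "N \<ge> Suc (length \<sigma>)" for N
      proof -
        have "N - length \<sigma> = Suc (N - Suc (length \<sigma>))" using that by simp
        then show ?thesis by (simp only: A_def avg_snoc) (simp add: blinfun.bilinear_simps)
      qed
      then have "\<forall>\<^sub>F N in U. (1 / 2) *\<^sub>R (A (N - length (True # \<sigma>)) (True # \<sigma>) y
          + A (N - length (False # \<sigma>)) (False # \<sigma>) y) = A (N - length \<sigma>) \<sigma> y"
        by (intro filter_leD[OF U(2)] eventually_sequentiallyI[of "Suc (length \<sigma>)"]) simp
      moreover have "((\<lambda>N. (1 / 2) *\<^sub>R (A (N - length (True # \<sigma>)) (True # \<sigma>) y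
          + A (N - length (False # \<sigma>)) (False # \<sigma>) y))
          \<longlongrightarrow> (1 / 2) *\<^sub>R (\<Phi> (True # \<sigma>) y + \<Phi> (False # \<sigma>) y)) U"
        by (intro tendsto_intros \<Phi>)
      ultimately have "((\<lambda>N. A (N - length \<sigma>) \<sigma> y)
          \<longlongrightarrow> (1 / 2) *\<^sub>R (\<Phi> (True # \<sigma>) y + \<Phi> (False # \<sigma>) y)) U"
        by (rule Lim_transform_eventually[rotated])
      from tendsto_unique[OF U(1) \<Phi>(2) this]
      show "\<Phi> \<sigma> y = ((1 / 2) *\<^sub>R (\<Phi> (True # \<sigma>) + \<Phi> (False # \<sigma>))) y"
        by (simp add: blinfun.bilinear_simps)
    qed
    \<comment> \<open>All descendants of \<open>b # \<sigma>\<close> take the value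
      \<open>V \<sigma> b\<close> here, so averaging preserves the gap.\<close>
    have "A N (b # \<sigma>) (x (length \<sigma>)) = V \<sigma> b" for N b \<sigma>
      by (simp add: A_def avg_eval \<phi>V avg_const)
    then have "\<Phi> (b # \<sigma>) (x (length \<sigma>)) = V \<sigma> b" for b \<sigma>
      using tendsto_unique[OF U(1) \<Phi>(2)[of "b # \<sigma>" "x (length \<sigma>)"], of "V \<sigma> b"] by simp
    then have "\<theta> / 2 \<le> \<Phi> (True # \<sigma>) (x (length \<sigma>)) - \<Phi> (False # \<sigma>) (x (length \<sigma>))" for \<sigma>
      using V(2) by simp
    moreover have "norm (x k) \<le> 1" for k
      using split[of "replicate k True"] by (simp add: splits_def)
    ultimately show False
      using no_martingale_tree[OF LKK mart \<Phi>(1), of x "\<theta> / 2"] \<open>0 < \<theta>\<close> by simp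
  qed
  with g(3) have "\<exists>l. (\<lambda>n. g n x) \<longlonglongrightarrow> l" for x
    by (intro oscillation_le_0_convergent) simp
  with pointwise_limit_blinfun[where f = g, OF _ gn, of sequentially] g(1) that
  show thesis by (metis sequentially_bot)
qed

subsection \<open>Subsequences\<close>

text \<open>The set \<open>T\<close> consists of the rational linear combinations, coded by lists of
  coefficient-vector pairs.\<close>

lemma countable_dense_in_span:
  fixes S :: "'v::real_normed_vector set"
  assumes "countable S"
  obtains T where "countable T" "\<And>u e. u \<in> span S \<Longrightarrow> 0 < e \<Longrightarrow> \<exists>t\<in>T. norm (u - t) < e"
proof -
  define L where "L l = (\<Sum>(q, v)\<leftarrow>l. of_rat q *\<^sub>R v)" for l :: "(rat \<times> 'v) list"
  have "countable (L ` lists (UNIV \<times> S))"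
    using assms by (intro countable_image countable_lists countable_SIGMA) auto
  moreover have "\<exists>t\<in>L ` lists (UNIV \<times> S). norm (u - t) < e" if "u \<in> span S" "0 < e" for u e
    using that
  proof (induction u arbitrary: e rule: span_induct_alt)
    case base
    then show ?case by (intro bexI[of _ "L []"] imageI) (auto simp: L_def)
  next
    case (step c x y)
    from step(2)[of "e / 2"] step(3) obtain l where l: "l \<in> lists (UNIV \<times> S)" "norm (y - L l) < e / 2"
      by auto
    define a where "a = norm x + 1"
    have a: "0 < a" "norm x < a" by (auto simp: a_def add_nonneg_pos)
    with step(3) have "c < c + e / (2 * a)" by simp
    then obtain q where q: "c < of_rat q" "of_rat q < c + e / (2 * a)"
      using of_rat_dense by blast
    then have "\<bar>c - of_rat q\<bar> * norm x \<le> e / (2 * a) * a"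
      using a by (intro mult_mono) auto
    then have "norm ((c - of_rat q) *\<^sub>R x) \<le> e / 2" using a by simp
    moreover have eq: "(c *\<^sub>R x + y) - L ((q, x) # l) = (c - of_rat q) *\<^sub>R x + (y - L l)"
      by (simp add: L_def algebra_simps)
    ultimately have "norm ((c *\<^sub>R x + y) - L ((q, x) # l)) < e"
      unfolding eq using norm_triangle_ineq[of "(c - of_rat q) *\<^sub>R x" "y - L l"] l(2) by linarith
    then show ?case
      using l(1) step(1) by (intro bexI[of _ "L ((q, x) # l)"] imageI) auto
  qed
  ultimately show thesis using that by blast
qed

lemma uncountable_branches: "uncountable (UNIV :: (nat \<Rightarrow> bool) set)"
proof
  assume "countable (UNIV :: (nat \<Rightarrow> bool) set)"
  then obtain h :: "nat \<Rightarrow> nat \<Rightarrow> bool" where "range h = UNIV"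
    using uncountable_def by blast
  then obtain m where "h m = (\<lambda>n. \<not> h n n)" by (metis rangeE UNIV_I)
  then show False by metis
qed

lemma weak_star_convergent_subsequence:
  fixes f :: "nat \<Rightarrow> 'a::banach \<Rightarrow>\<^sub>L real"
  assumes LKK: "\<forall>\<epsilon>>0. LKK_star TYPE('a) \<inter> pi_one_plus \<epsilon> \<noteq> {}"
    and f: "\<And>n. norm (f n) \<le> 1"
  obtains g z where "refines (\<lambda>_. True) g f" "\<And>x. (\<lambda>n. g n x) \<longlonglongrightarrow> blinfun_apply z x"
proof -
  let ?R = "refines (\<lambda>_. True)"
  have cvx: "refines convex h g" if "?R h g" for h g :: "nat \<Rightarrow> 'a \<Rightarrow>\<^sub>L real"
    by (rule refines_imp_convex[OF that]) simp
  obtain g \<theta> where g: "?R g f" "0 \<le> \<theta>" "oscillation_le g \<theta>"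
    and stable: "\<And>h c. ?R h g \<Longrightarrow> 0 \<le> c \<Longrightarrow> oscillation_le h c \<Longrightarrow> \<theta> \<le> c"
    by (rule stable_oscillation[where f = f and P = "\<lambda>_. True", OF f]) blast+
  have norm_g: "norm (h n) \<le> 1" if "?R h g" for h n
    by (rule refines_norm_le[OF cvx[OF refines_trans[OF that g(1)]] f])
  have "\<theta> = 0"
  proof (rule ccontr)
    assume "\<theta> \<noteq> 0"
    with g(2) have "0 < \<theta>" by simp
    then obtain r s where rs: "0 < r" "r \<le> 1" "0 < s" "s \<le> 1" "has_LKK_star TYPE('a) r s" "1 - r < \<theta> / 32 * s"
      using LKK_star_pair[OF LKK, of "\<theta> / 32"] by auto
    \<comment> \<open>The final estimate tolerates a norm excess of \<open>2 * \<eta>\<close>, that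
      is \<open>\<theta> / 32 * s\<close>, the same amount that bounds \<open>1 - r\<close>.\<close>
    define \<eta> where "\<eta> = \<theta> / 64 * s"
    have "0 < \<eta>" using \<open>0 < \<theta>\<close> rs by (simp add: \<eta>_def)
    define low where "low h = (INF z\<in>cluster h. norm z)" for h :: "nat \<Rightarrow> 'a \<Rightarrow>\<^sub>L real"
    have bdd: "bdd_below (norm ` cluster h)" for h :: "nat \<Rightarrow> 'a \<Rightarrow>\<^sub>L real"
      by (auto intro!: bdd_belowI[of _ 0])
    have low_le: "low h \<le> norm z" if "z \<in> cluster h" for h z
      unfolding low_def by (rule cINF_lower[OF bdd that])
    have low_le_1: "low h \<le> 1" if h: "?R h g" for h
    proof -
      obtain z where "z \<in> cluster h" using cluster_nonempty[of h 1] norm_g[OF h] by blast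
      with low_le cluster_norm_le[OF _ norm_g[OF h]] show ?thesis by (meson order_trans)
    qed
    \<comment> \<open>Refining shrinks the cluster set, so \<open>low\<close> can only grow. Once
      \<open>g1\<close> is within \<eta> of the supremum, refinements of \<open>g1\<close> raise
      \<open>low\<close> by less than \<eta>.\<close>
    define top where "top = Sup {low h | h. ?R h g}"
    have bdd_top: "bdd_above {low h | h. ?R h g}"
      by (rule bdd_aboveI[of _ 1]) (use low_le_1 in auto)
    have "{low h | h. ?R h g} \<noteq> {}" using refines_refl by blast
    then obtain g1 where g1: "?R g1 g" "top - \<eta> < low g1"
      using less_cSupD[of "{low h | h. ?R h g}" "top - \<eta>"] \<open>0 < \<eta>\<close> by (auto simp: top_def)
    have low_g1: "low h < low g1 + \<eta>" if "?R h g1" for h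
    proof -
      have "low h \<le> top"
        unfolding top_def using refines_trans[OF that g1(1)] by (intro cSup_upper[OF _ bdd_top]) blast
      with g1(2) show ?thesis by simp
    qed
    have norm_g1: "norm (h n) \<le> 1" if "?R h g1" for h n
      by (rule norm_g[OF refines_trans[OF that g1(1)]])

    define \<kappa> where "\<kappa> p b = (if b then fst (snd p) else snd (snd p))"
      for p :: "'a \<times> (nat \<Rightarrow> nat) \<times> (nat \<Rightarrow> nat)" and b
    \<comment> \<open>Here every node is split on its own, with its own vector; this is the case
      \<open>k = 0\<close> of the simultaneous splitting, where the mean over words is the sequence
      itself.\<close>
    define S where "S h = (SOME p. splits (\<theta> / 2) h (fst p) (\<kappa> p True) (\<kappa> p False))"
      for h :: "nat \<Rightarrow> 'a \<Rightarrow>\<^sub>L real"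
    have S: "splits (\<theta> / 2) h (fst (S h)) (\<kappa> (S h) True) (\<kappa> (S h) False)" if "?R h g1" for h
    proof -
      have hg: "?R h g" by (rule refines_trans[OF that g1(1)])
      have "\<exists>x \<rho> \<tau>. \<forall>\<sigma>. length \<sigma> = 0 \<longrightarrow> splits (\<theta> / 2) ((\<lambda>_ :: bool list. h) \<sigma>) x \<rho> \<tau>"
        by (rule simultaneous_split[OF norm_g[OF refines_refl] _ \<open>0 < \<theta>\<close> g(3) stable hg]) (simp_all add: hg)
      then obtain x \<rho> \<tau> where "splits (\<theta> / 2) h x \<rho> \<tau>" by auto
      then have "\<exists>p. splits (\<theta> / 2) h (fst p) (\<kappa> p True) (\<kappa> p False)"
        by (intro exI[of _ "(x, \<rho>, \<tau>)"]) (simp add: \<kappa>_def)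
      from someI_ex[OF this] show ?thesis unfolding S_def .
    qed
    define t where "t = rec_list g1 (\<lambda>b _ h n. h (\<kappa> (S h) b n))"
    have t: "t [] = g1" "t (b # \<sigma>) = (\<lambda>n. t \<sigma> (\<kappa> (S (t \<sigma>)) b n))" for b \<sigma>
      by (simp_all add: t_def)
    have child: "?R (t (b # \<sigma>)) (t \<sigma>)" if "?R (t \<sigma>) g1" for b \<sigma>
      unfolding t by (rule refines_subseq) (use S[OF that] in \<open>cases b; simp add: splits_def\<close>)
    have tg: "?R (t \<sigma>) g1" for \<sigma>
      by (induction \<sigma>) (simp add: t refines_refl, rule refines_trans[OF child])
    define x where "x \<sigma> = fst (S (t \<sigma>))" for \<sigma>
    have norm_x: "norm (x \<sigma>) \<le> 1" for \<sigma>
      using S[OF tg] by (simp add: x_def splits_def)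
    have "\<exists>v. (\<forall>b. (\<lambda>n. t (b # \<sigma>) n (x \<sigma>)) \<longlonglongrightarrow> v b) \<and> \<theta> / 2 \<le> v True - v False" for \<sigma>
    proof -
      obtain v where v: "\<And>b. (\<lambda>n. t \<sigma> ((if b then \<kappa> (S (t \<sigma>)) True else \<kappa> (S (t \<sigma>)) False) n) (x \<sigma>)) \<longlonglongrightarrow> v b"
          "\<theta> / 2 \<le> v True - v False"
        unfolding x_def by (rule splits_children[OF S[OF tg[of \<sigma>]]]) blast
      have "(\<lambda>n. t (b # \<sigma>) n (x \<sigma>)) \<longlonglongrightarrow> v b" for b
        using v(1)[of b] by (cases b) (simp_all add: t)
      with v(2) show ?thesis by blast
    qed
    then obtain V where V: "\<And>\<sigma> b. (\<lambda>n. t (b # \<sigma>) n (x \<sigma>)) \<longlonglongrightarrow> V \<sigma> b"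
        "\<And>\<sigma>. \<theta> / 2 \<le> V \<sigma> True - V \<sigma> False"
      by metis

    \<comment> \<open>\<open>pre \<beta> n\<close> is the node reached after \<open>n\<close>
      letters of the branch \<beta>, newest letter first; \<open>fb \<beta>\<close> below is the
      diagonal sequence down that branch.\<close>
    define pre where "pre \<beta> = rec_nat [] (\<lambda>n \<sigma>. \<beta> n # \<sigma>)" for \<beta> :: "nat \<Rightarrow> bool"
    have pre: "pre \<beta> 0 = []" "pre \<beta> (Suc n) = \<beta> n # pre \<beta> n" for \<beta> n
      by (simp_all add: pre_def)
    have pre_cong: "pre \<beta> j = pre \<beta>' j" if "\<And>i. i < j \<Longrightarrow> \<beta> i = \<beta>' i" for \<beta> \<beta>' j
      using that by (induction j) (simp_all add: pre)
    define fb where "fb \<beta> n = t (pre \<beta> n) n" for \<beta> n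
    have "?R (t (pre \<beta> (Suc j))) (t (pre \<beta> j))" for \<beta> j
      unfolding pre by (rule child[OF tg])
    then have fb: "?R (\<lambda>n. fb \<beta> (n + j)) (t (pre \<beta> j))" for \<beta> j
      unfolding fb_def by (rule refines_diagonal)
    have fb_g1: "?R (fb \<beta>) g1" for \<beta>
      using fb[of \<beta> 0] by (simp add: pre t)
    have "\<exists>z\<in>cluster (fb \<beta>). norm z < low g1 + 2 * \<eta>" for \<beta>
    proof -
      have "cluster (fb \<beta>) \<noteq> {}" using cluster_nonempty norm_g1[OF fb_g1] by blast
      moreover have "low (fb \<beta>) < low g1 + 2 * \<eta>"
        using low_g1[OF fb_g1, of \<beta>] \<open>0 < \<eta>\<close> by simp
      ultimately show ?thesis unfolding low_def[of "fb \<beta>"] by (simp add: cINF_less_iff[OF _ bdd])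
    qed
    then obtain z where z: "\<And>\<beta>. z \<beta> \<in> cluster (fb \<beta>)" "\<And>\<beta>. norm (z \<beta>) < low g1 + 2 * \<eta>"
      by metis
    have z_pre: "z \<beta> \<in> cluster (t (pre \<beta> j))" for \<beta> j
      using z(1) cluster_offset cluster_refines[OF cvx[OF fb]] by blast
    \<comment> \<open>One level further down the values at \<open>x (pre \<beta> j)\<close>
      converge, which fixes the value of every cluster point there.\<close>
    have zV: "z \<beta> (x (pre \<beta> j)) = V (pre \<beta> j) (\<beta> j)" for \<beta> j
      using cluster_eval_eq[OF z_pre[of \<beta> "Suc j", unfolded pre] V(1)] .

    define D where "D = {\<beta> :: nat \<Rightarrow> bool. finite {n. \<beta> n}}"
    have "D = (\<lambda>A n. n \<in> A) ` {A. finite A}"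
    proof -
      have "\<beta> \<in> (\<lambda>A n. n \<in> A) ` {A. finite A}" if "finite {n. \<beta> n}" for \<beta> :: "nat \<Rightarrow> bool"
        by (rule image_eqI[of _ _ "{n. \<beta> n}"]) (use that in auto)
      then show ?thesis by (auto simp: D_def)
    qed
    then have "countable D" by (simp add: countable_Collect_finite)
    then obtain T where T: "countable T"
        "\<And>u e. u \<in> span (z ` D) \<Longrightarrow> 0 < e \<Longrightarrow> \<exists>t\<in>T. norm (u - t) < e"
      by (rule countable_dense_in_span[OF countable_image]) blast
    \<comment> \<open>Otherwise each \<open>z \<beta>\<close> is within \<open>\<theta> / 8\<close>
      of some \<open>u \<beta>\<close> along its branch, hence within \<open>\<theta> / 4\<close> of
      some \<open>w \<beta>\<close> in the countable set \<open>T\<close>. The map \<open>w\<close>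
      would be injective on an uncountable set.\<close>
    have "\<exists>\<beta>. \<forall>u\<in>convex hull (z ` D). \<exists>j. \<theta> / 8 \<le> \<bar>z \<beta> (x (pre \<beta> j)) - u (x (pre \<beta> j))\<bar>"
    proof (rule ccontr)
      assume "\<not> ?thesis"
      then have "\<forall>\<beta>. \<exists>u\<in>convex hull (z ` D). \<forall>j. \<bar>z \<beta> (x (pre \<beta> j)) - u (x (pre \<beta> j))\<bar> < \<theta> / 8"
        by (auto simp: not_le)
      then obtain u where u: "\<And>\<beta>. u \<beta> \<in> convex hull (z ` D)"
          "\<And>\<beta> j. \<bar>z \<beta> (x (pre \<beta> j)) - u \<beta> (x (pre \<beta> j))\<bar> < \<theta> / 8"
        by metis
      have "\<forall>\<beta>. \<exists>w\<in>T. norm (u \<beta> - w) < \<theta> / 8"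
        using T(2) u(1) convex_hull_subset_span \<open>0 < \<theta>\<close> by (metis divide_pos_pos subsetD zero_less_numeral)
      then obtain w where w: "\<And>\<beta>. w \<beta> \<in> T" "\<And>\<beta>. norm (u \<beta> - w \<beta>) < \<theta> / 8" by metis
      have close: "\<bar>z \<beta> (x (pre \<beta> j)) - w \<beta> (x (pre \<beta> j))\<bar> < \<theta> / 4" for \<beta> j
      proof -
        have "\<bar>(u \<beta> - w \<beta>) (x (pre \<beta> j))\<bar> \<le> norm (u \<beta> - w \<beta>) * norm (x (pre \<beta> j))"
          using norm_blinfun[of "u \<beta> - w \<beta>"] by simp
        also have "\<dots> \<le> norm (u \<beta> - w \<beta>)" by (simp add: mult_left_le norm_x)
        finally show ?thesis using w(2)[of \<beta>] u(2)[of \<beta> j] unfolding blinfun.diff_left by linarith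
      qed
      have "inj w"
      proof (rule injI, rule ccontr)
        fix \<beta> \<beta>' assume eq: "w \<beta> = w \<beta>'" and "\<beta> \<noteq> \<beta>'"
        then have ex: "\<exists>j. \<beta> j \<noteq> \<beta>' j" by auto
        \<comment> \<open>Up to the first disagreement the branches share the node
          \<open>pre \<beta> j\<close>, where the two values differ by at least
          \<open>\<theta> / 2\<close>; a common \<open>w\<close> would put both within
          \<open>\<theta> / 4\<close> of one number.\<close>
        define j where "j = (LEAST j. \<beta> j \<noteq> \<beta>' j)"
        have j: "\<beta> j \<noteq> \<beta>' j" unfolding j_def using ex by (rule LeastI_ex)
        have pre_eq: "pre \<beta> j = pre \<beta>' j"
          by (rule pre_cong) (use not_less_Least j_def in blast)
        have "\<bar>V (pre \<beta> j) (\<beta> j) - V (pre \<beta> j) (\<beta>' j)\<bar> < \<theta> / 2"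
          using close[of \<beta> j] close[of \<beta>' j] unfolding zV eq unfolding pre_eq by linarith
        then show False
          using V(2)[of "pre \<beta> j"] j unfolding abs_less_iff by (cases "\<beta> j") auto
      qed
      moreover have "countable (range w)"
        using T(1) w(1) by (meson countable_subset image_subsetI)
      ultimately show False using uncountable_branches countable_image_inj_on by blast
    qed
    then obtain \<beta> where \<beta>: "\<And>u. u \<in> convex hull (z ` D) \<Longrightarrow> \<exists>j. \<theta> / 8 \<le> \<bar>z \<beta> (x (pre \<beta> j)) - u (x (pre \<beta> j))\<bar>"
      by blast

    \<comment> \<open>The truncations lie in \<open>D\<close>, and \<open>trunc k\<close> follows
      \<beta> through its first \<open>k\<close> letters, so \<open>d k\<close> agrees with
      \<open>z \<beta>\<close> on the first \<open>k\<close> vectors along \<beta>.\<close>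
    define trunc where "trunc k = (\<lambda>n. n < k \<and> \<beta> n)" for k
    define d where "d k = z (trunc k)" for k
    have trunc_D: "trunc k \<in> D" for k by (simp add: D_def trunc_def)
    have norm_d: "norm (d k) \<le> 1" for k
      unfolding d_def using z(1) by (rule cluster_norm_le) (rule norm_g1[OF fb_g1])
    have d_eval: "d k (x (pre \<beta> j)) = z \<beta> (x (pre \<beta> j))" if "j < k" for j k
    proof -
      have "pre (trunc k) j = pre \<beta> j" by (rule pre_cong) (use that in \<open>simp add: trunc_def\<close>)
      then show ?thesis
        using zV[of "trunc k" j] zV[of \<beta> j] that by (simp add: d_def trunc_def)
    qed
    obtain v w where vw: "refines convex v d" "\<And>x. (\<lambda>n. v n x) \<longlonglongrightarrow> blinfun_apply w x"
      by (rule convex_block_convergent[where f = d, OF LKK norm_d]) blast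
    have v_hull: "v n \<in> convex hull (z ` D)" for n
    proof -
      have "d ` {n..} \<subseteq> z ` D" using trunc_D by (auto simp: d_def)
      from hull_mono[OF this] show ?thesis using vw(1) unfolding refines_def by blast
    qed
    have v_eval: "v n (x (pre \<beta> j)) = z \<beta> (x (pre \<beta> j))" if "j < n" for j n
    proof -
      have "convex {u :: 'a \<Rightarrow>\<^sub>L real. u (x (pre \<beta> j)) = c}" for c
        unfolding convex_def by (auto simp: blinfun.bilinear_simps simp flip: distrib_right)
      then have "convex hull (d ` {n..}) \<subseteq> {u. blinfun_apply u (x (pre \<beta> j)) = z \<beta> (x (pre \<beta> j))}"
        by (intro hull_minimal) (use d_eval that in auto)
      then show ?thesis using vw(1) by (auto simp: refines_def)
    qed
    have w_eval: "w (x (pre \<beta> j)) = z \<beta> (x (pre \<beta> j))" for j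
    proof (rule LIMSEQ_unique[OF vw(2)])
      show "(\<lambda>n. v n (x (pre \<beta> j))) \<longlonglongrightarrow> z \<beta> (x (pre \<beta> j))"
        by (rule tendsto_eventually) (use v_eval in \<open>auto intro!: eventually_sequentiallyI[of "Suc j"]\<close>)
    qed
    have z_g1: "z ` D \<subseteq> cluster g1"
      using z_pre[of _ 0] by (auto simp: pre t)
    have "v n \<in> cluster g1" for n
      using v_hull hull_minimal[of _ _ convex, OF z_g1 convex_cluster] by blast
    then have "low g1 \<le> norm w"
      by (intro low_le cluster_closed[OF _ vw(2)])
    have "r * norm w + s * (\<theta> / 8) \<le> low g1 + 2 * \<eta>"
    proof (rule LKK_gap[OF rs(5,3) vw(2)])
      show "norm (v n) \<le> low g1 + 2 * \<eta>" for n
        by (rule refines_norm_le[OF vw(1)]) (simp add: d_def z(2) less_imp_le)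
      show "\<theta> / 8 \<le> norm (v n - w)" for n
      proof -
        obtain j where "\<theta> / 8 \<le> \<bar>z \<beta> (x (pre \<beta> j)) - v n (x (pre \<beta> j))\<bar>"
          using \<beta>[OF v_hull] by blast
        also have "\<dots> = \<bar>(v n - w) (x (pre \<beta> j))\<bar>"
          by (simp add: blinfun.diff_left w_eval)
        also have "\<dots> \<le> norm (v n - w) * norm (x (pre \<beta> j))"
          using norm_blinfun[of "v n - w"] by simp
        also have "\<dots> \<le> norm (v n - w)" by (simp add: mult_left_le norm_x)
        finally show ?thesis .
      qed
    qed
    \<comment> \<open>Being in \<open>cluster g1\<close>, the limit \<open>w\<close> has norm at
      least \<open>low g1\<close>. The inequalities then give \<open>s * \<theta> / 8 \<le> (1 - r)
      + 2 * \<eta> < s * \<theta> / 16\<close>.\<close>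
    moreover have "r * low g1 \<le> r * norm w"
      using rs \<open>low g1 \<le> norm w\<close> by simp
    moreover have "(1 - r) * low g1 \<le> (1 - r) * 1"
      using rs low_le_1[OF g1(1)] by (intro mult_left_mono) auto
    moreover have "0 < s * \<theta>" using rs \<open>0 < \<theta>\<close> by simp
    ultimately show False using rs(6) by (simp add: \<eta>_def algebra_simps)
  qed
  with g(3) have "\<exists>l. (\<lambda>n. g n x) \<longlonglongrightarrow> l" for x
    by (intro oscillation_le_0_convergent) simp
  with pointwise_limit_blinfun[where f = g, OF _ norm_g[OF refines_refl], of sequentially] g(1) that
  show thesis by (metis sequentially_bot)
qed

lemma Hausdorff_weak_star: "Hausdorff_space (weak_star_topology :: ('a::banach \<Rightarrow>\<^sub>L real) topology)"
  unfolding Hausdorff_space_def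
proof (intro allI impI)
  fix f g :: "'a \<Rightarrow>\<^sub>L real"
  assume "f \<in> topspace weak_star_topology \<and> g \<in> topspace weak_star_topology \<and> f \<noteq> g"
  then obtain x where "f x \<noteq> g x" using blinfun_eqI by metis
  then obtain U V where UV: "open U" "open V" "f x \<in> U" "g x \<in> V" "U \<inter> V = {}"
    using hausdorff by metis
  have "openin weak_star_topology {h. blinfun_apply h x \<in> W}" if "open W" for W
    using openin_continuous_map_preimage[OF strong_operator_topology_continuous_evaluation[of x], of W] that
    by (simp add: strong_operator_topology_topspace)
  with UV show "\<exists>U V. openin weak_star_topology U \<and> openin weak_star_topology V \<and> f \<in> U \<and> g \<in> V \<and> disjnt U V"
    by (intro exI[of _ "{h. blinfun_apply h x \<in> U}"] exI[of _ "{h. blinfun_apply h x \<in> V}"])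
      (auto simp: disjnt_def)
qed

subsection \<open>The uniform Kadec-Klee property\<close>

lemma UKK_star_of_LKK_star:
  assumes LKK: "\<forall>\<epsilon>>0. LKK_star TYPE('a::banach) \<inter> pi_one_plus \<epsilon> \<noteq> {}"
  shows "has_UKK_star TYPE('a)"
  unfolding has_UKK_star_def
proof (intro allI impI)
  fix \<epsilon> :: real assume "0 < \<epsilon>"
  then obtain r s where rs: "0 < r" "r \<le> 1" "0 < s" "s \<le> 1" "has_LKK_star TYPE('a) r s" "1 - r < \<epsilon> / 8 * s"
    using LKK_star_pair[OF LKK, of "\<epsilon> / 8"] by auto
  \<comment> \<open>The first entry is what remains of the gain \<open>s * \<epsilon> / 4\<close>
    after paying for \<open>1 - r\<close>; the second keeps \<delta> below 1.\<close>
  define \<delta> where "\<delta> = min (\<epsilon> / 8 * s) (1 / 2)"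
  have \<delta>: "\<delta> \<in> {0<..<1}" using rs \<open>0 < \<epsilon>\<close> by (auto simp: \<delta>_def)
  show "eps_UKK_star TYPE('a) \<epsilon>"
    unfolding eps_UKK_star_def
  proof (rule bexI[OF _ \<delta>], intro allI impI, elim conjE)
    fix C :: "('a \<Rightarrow>\<^sub>L real) set"
    assume C: "C \<noteq> {}" "compactin weak_star_topology C" "convex C" "C \<subseteq> cball 0 1"
      and sup: "\<epsilon> \<le> Sup {sep x | x :: nat \<Rightarrow> 'a \<Rightarrow>\<^sub>L real. range x \<subseteq> C}"
    have "{sep x | x :: nat \<Rightarrow> 'a \<Rightarrow>\<^sub>L real. range x \<subseteq> C} \<noteq> {}"
      using C(1) by (auto intro: exI[of _ "\<lambda>_. SOME c. c \<in> C"] simp: some_in_eq)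
    from less_cSupD[OF this, of "\<epsilon> / 2"] sup \<open>0 < \<epsilon>\<close>
    obtain f :: "nat \<Rightarrow> 'a \<Rightarrow>\<^sub>L real" where f: "range f \<subseteq> C" "\<epsilon> / 2 < sep f" by force
    have f_sep: "\<epsilon> / 2 < norm (f n - f m)" if "n \<noteq> m" for n m
    proof -
      have "sep f \<le> norm (f n - f m)"
        unfolding sep_def by (rule cInf_lower) (use that in \<open>auto intro!: bdd_belowI[of _ 0]\<close>)
      with f(2) show ?thesis by simp
    qed
    have norm_f: "norm (f n) \<le> 1" for n using f(1) C(4) by (auto simp: subset_iff)
    obtain g w where gw: "refines (\<lambda>_. True) g f" "\<And>x. (\<lambda>n. g n x) \<longlonglongrightarrow> blinfun_apply w x"
      by (rule weak_star_convergent_subsequence[where f = f, OF LKK norm_f]) blast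
    have g_f: "g n \<in> f ` {n..}" for n
      using gw(1) hull_same[of "\<lambda>_. True" "f ` {n..}"] unfolding refines_def by metis
    \<comment> \<open>By separation, at most one index \<open>i\<close> has \<open>f i\<close>
      within \<open>\<epsilon> / 4\<close> of \<open>w\<close>; since \<open>g n\<close> is a term
      of index at least \<open>n\<close>, it avoids that index once \<open>n > i\<close>.\<close>
    have "\<exists>N. \<forall>n\<ge>N. \<epsilon> / 4 \<le> norm (g n - w)"
    proof (cases "\<exists>i. norm (f i - w) < \<epsilon> / 4")
      case True
      then obtain i where i: "norm (f i - w) < \<epsilon> / 4" by blast
      have "\<epsilon> / 4 \<le> norm (g n - w)" if n: "n \<ge> Suc i" for n
      proof -
        obtain m where m: "g n = f m" "m \<ge> n" using g_f[of n] by auto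
        then have "\<epsilon> / 2 < norm (f m - f i)" using f_sep n by simp
        also have "\<dots> \<le> norm (f m - w) + norm (f i - w)"
          using norm_triangle_ineq4[of "f m - w" "f i - w"] by simp
        finally show ?thesis using i m(1) by simp
      qed
      then show ?thesis by blast
    next
      case False
      then show ?thesis using g_f by (metis imageE not_less)
    qed
    then obtain N where N: "\<And>n. n \<ge> N \<Longrightarrow> \<epsilon> / 4 \<le> norm (g n - w)" by blast
    have "r * norm w + s * (\<epsilon> / 4) \<le> 1"
    proof (rule LKK_gap[OF rs(5,3), of "\<lambda>n. g (n + N)"])
      show "(\<lambda>n. g (n + N) x) \<longlonglongrightarrow> w x" for x
        using gw(2) by (rule LIMSEQ_ignore_initial_segment)
      show "norm (g (n + N)) \<le> 1" for n
        using g_f[of "n + N"] norm_f by auto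
    qed (use N in simp)
    \<comment> \<open>As \<open>1 < r + \<epsilon> / 8 * s\<close>, the gap estimate yields \<open>r
      * norm w < r - \<epsilon> / 8 * s \<le> r - \<delta> \<le> r * (1 - \<delta>)\<close>.\<close>
    moreover have "r * \<delta> \<le> \<delta>" using rs \<delta> by (simp add: mult_left_le_one_le)
    moreover have "\<delta> \<le> \<epsilon> / 8 * s" by (simp add: \<delta>_def)
    ultimately have "r * norm w \<le> r * (1 - \<delta>)"
      using rs(6) by (simp add: algebra_simps)
    then have "norm w \<le> 1 - \<delta>" using rs(1) by simp
    moreover have "w \<in> C"
    proof (rule limitin_closedin)
      show "limitin weak_star_topology g w sequentially"
        using gw(2) by (simp add: limitin_weak_star_iff)
      show "closedin weak_star_topology C"
        by (rule compactin_imp_closedin[OF Hausdorff_weak_star C(2)])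
      show "\<forall>\<^sub>F n in sequentially. g n \<in> C"
        using g_f f(1) by (intro always_eventually allI) blast
    qed simp
    ultimately show "C \<inter> cball 0 (1 - \<delta>) \<noteq> {}" by auto
  qed
qed

theorem proposition3p5:
  shows "((\<forall>\<epsilon>>0. LKK_star TYPE('a::banach) \<inter> pi_one_plus \<epsilon> \<noteq> {}) \<longrightarrow> has_UKK_star TYPE('a)) \<and>
         ((\<exists>s\<in>{0<..1}. has_LKK_star TYPE('a) 1 s) \<longrightarrow> has_UKK_star TYPE('a))"
proof (intro conjI impI)
  assume "\<exists>s\<in>{0<..1}. has_LKK_star TYPE('a) 1 s"
  then obtain s where "s \<in> {0<..1}" "has_LKK_star TYPE('a) 1 s" by blast
  then have "(1, s) \<in> LKK_star TYPE('a) \<inter> pi_one_plus \<epsilon>" if "0 < \<epsilon>" for \<epsilon>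
    using that by (simp add: LKK_star_def pi_one_plus_def)
  then show "has_UKK_star TYPE('a)" by (intro UKK_star_of_LKK_star) blast
qed (rule UKK_star_of_LKK_star)

end
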